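(* Let $c$ be a constant with $c<100\log 2-2$. For every $\varepsilon>0$ there exists an integer $n_0$ with the following property. Let $h\ge 1$, let $t$ be a positive integer, and let \[\rho(x_1,\ldots,x_h,y)=\psi(x_1,\ldots,x_h)+vy,\qquad \psi(x_1,\ldots,x_h)=u_1x_1+\cdots+u_hx_h,\] be a linear form with nonzero integer coefficients $u_1,\ldots,u_h,v$. Let $\mathcal{A}=(A_1,\ldots,A_h)$ be an $h$-tuple of nonempty finite sets of integers and let $\mathrm{diam}(\psi(\mathcal{A}))=\max(\psi(\mathcal{A}))-\min(\psi(\mathcal{A}))$. Assume that $\mathrm{diam}(\psi(\mathcal{A}))\ge n_0$ and that $\prod_{i=1}^h|A_i|\le(\mathrm{diam}(\psi(\mathcal{A}))+1)^c$. If $B$ is a set of integers such that $\mathcal{A}$ and $B$ are $t$-complementing sets of integers with respect to $\rho$, then $B$ is periodic with a period $k$ satisfying \[\log k\le(\mathrm{diam}(\psi(\mathcal{A}))+1)^{\frac13+\varepsilon}.\]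
   Context: $\psi(\mathcal{A})=\{u_1a_1+\cdots+u_ha_h: a_i\in A_i\}$ and $\rho(\mathcal{A},B)=\{u_1a_1+\cdots+u_ha_h+vb: a_i\in A_i, b\in B\}$. The representation function is $R^{(\rho)}_{\mathcal{A},B}(n)=\mathrm{card}\{(a_1,\ldots,a_h,b)\in A_1\times\cdots\times A_h\times B:\rho(a_1,\ldots,a_h,b)=n\}$. $\mathcal{A}$ and $B$ are $t$-complementing with respect to $\rho$ if $\rho(\mathcal{A},B)=\mathbb{Z}$ and $R^{(\rho)}_{\mathcal{A},B}(n)=t$ for all $n\in\mathbb{Z}$. A set $B$ is periodic with period $k\in\mathbb{Z}_{>0}$ if $B+\{k\}=B$. $\log$ is the natural logarithm. *)

theory Defs
  imports Complex_Main "HOL-Library.FuncSet" "HOL-Library.Set_Algebras"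
begin

text \<open>An \<open>h\<close>-tuple is a function on \<open>nat\<close> of which only the values at \<open>1, \<dots>, h\<close> matter. Elements of
  \<open>A\<^sub>1 \<times> \<dots> \<times> A\<^sub>h\<close> are taken from \<^term>\<open>PiE {1..h} A\<close>, so that tuples are counted
  without repetition.\<close>

definition psi :: "nat \<Rightarrow> (nat \<Rightarrow> int) \<Rightarrow> (nat \<Rightarrow> int) \<Rightarrow> int" where
  "psi h u x = (\<Sum>i=1..h. u i * x i)"

definition rho :: "nat \<Rightarrow> (nat \<Rightarrow> int) \<Rightarrow> int \<Rightarrow> (nat \<Rightarrow> int) \<Rightarrow> int \<Rightarrow> int" where
  "rho h u v x y = psi h u x + v * y"

definition psi_set :: "nat \<Rightarrow> (nat \<Rightarrow> int) \<Rightarrow> (nat \<Rightarrow> int set) \<Rightarrow> int set" where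
  "psi_set h u A = {psi h u a | a. a \<in> PiE {1..h} A}"

definition rho_set :: "nat \<Rightarrow> (nat \<Rightarrow> int) \<Rightarrow> int \<Rightarrow> (nat \<Rightarrow> int set) \<Rightarrow> int set \<Rightarrow> int set" where
  "rho_set h u v A B = {rho h u v a b | a b. a \<in> PiE {1..h} A \<and> b \<in> B}"

text \<open>\<^term>\<open>card\<close> is 0 on infinite sets, so infinitely many representations would count
  as 0; the function is only ever compared with a positive \<open>t\<close>.\<close>

definition rep_fun ::
    "nat \<Rightarrow> (nat \<Rightarrow> int) \<Rightarrow> int \<Rightarrow> (nat \<Rightarrow> int set) \<Rightarrow> int set \<Rightarrow> int \<Rightarrow> nat" where
  "rep_fun h u v A B n = card {(a, b). a \<in> PiE {1..h} A \<and> b \<in> B \<and> rho h u v a b = n}"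

definition t_complementing ::
    "nat \<Rightarrow> nat \<Rightarrow> (nat \<Rightarrow> int) \<Rightarrow> int \<Rightarrow> (nat \<Rightarrow> int set) \<Rightarrow> int set \<Rightarrow> bool" where
  "t_complementing t h u v A B \<longleftrightarrow>
     rho_set h u v A B = UNIV \<and> (\<forall>n. rep_fun h u v A B n = t)"

definition diam :: "int set \<Rightarrow> int" where
  "diam S = Max S - Min S"

definition periodic_with :: "int set \<Rightarrow> int \<Rightarrow> bool" where
  "periodic_with B k \<longleftrightarrow> k > 0 \<and> B + {k} = B"

end

theory Submission
  imports Defs "HOL-Number_Theory.Number_Theory" "HOL-Computational_Algebra.Computational_Algebra"
begin

text \<open>
  Let \<open>n = diam(\<psi>(\<A>))\<close>, \<open>N = n + 1\<close> and let \<open>F\<close> be the polynomial of degree \<open>n\<close> with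
  nonnegative coefficients whose \<open>i\<close>-th coefficient counts the tuples with
  \<open>\<psi> = min \<psi>(\<A>) + i\<close>. The indicator function of \<open>vB\<close> solves the linear recurrence with
  characteristic polynomial \<open>F\<close> and constant right-hand side, so it is periodic by
  pigeonhole, and a period is any common multiple of the orders \<open>d\<close> of the roots of unity at
  which \<open>F\<close> vanishes, that is, of the \<open>d\<close> with \<open>\<Phi>\<^sub>d | F\<close>.

  Let \<open>r d\<close> be the multiplicity of \<open>\<Phi>\<^sub>d\<close> in \<open>F\<close>. The cofactor of \<open>\<Phi>\<^sub>m\<close> to the power
  \<open>r m\<close> has absolute value at most \<open>N\<close> to the power \<open>r m + c\<close> at primitive \<open>m\<close>-th roots of unity,
  while its norm is divisible by \<open>p\<close> to the power \<open>\<phi>(m) r(mq)\<close> for each prime power \<open>q = p\<^sup>a\<close>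
  coprime to \<open>m\<close>. Hence \<open>\<Sum> r(mq) ln p \<le> (r m + c) ln N\<close>, the sum running over such \<open>q\<close>. Starting from
  \<open>r 1 = 0\<close>, this gives \<open>\<Sum> r m \<le> X N\<^sup>\<epsilon>\<close> over \<open>m \<le> X\<close> by induction on the number of large primes
  dividing \<open>m\<close>. Together with \<open>\<Sum> \<phi>(d) r d \<le> n\<close> it follows that only
  \<open>N\<close> to the power \<open>1/3 + \<epsilon>\<close> primes divide the least common
  multiple of the \<open>d\<close>, each with a prime power of polynomial size in \<open>N\<close>.
\<close>

subsection \<open>Complex polynomials with integer coefficients\<close>

text \<open>Integer polynomials are kept inside \<open>complex poly\<close>, where they can be
  evaluated at roots of unity and split into linear factors without coercions.\<close>

definition int_coeffs :: "complex poly \<Rightarrow> bool" where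
  "int_coeffs p \<longleftrightarrow> (\<forall>i. coeff p i \<in> \<int>)"

lemma int_coeffsD: "int_coeffs p \<Longrightarrow> coeff p i \<in> \<int>"
  by (simp add: int_coeffs_def)

lemma int_coeffs_0 [simp, intro!]: "int_coeffs 0"
  and int_coeffs_1 [simp, intro!]: "int_coeffs 1"
  and int_coeffs_add [intro!]: "int_coeffs p \<Longrightarrow> int_coeffs q \<Longrightarrow> int_coeffs (p + q)"
  and int_coeffs_diff [intro!]: "int_coeffs p \<Longrightarrow> int_coeffs q \<Longrightarrow> int_coeffs (p - q)"
  and int_coeffs_mult [intro!]: "int_coeffs p \<Longrightarrow> int_coeffs q \<Longrightarrow> int_coeffs (p * q)"
  and int_coeffs_smult [intro!]: "c \<in> \<int> \<Longrightarrow> int_coeffs p \<Longrightarrow> int_coeffs (smult c p)"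
  and int_coeffs_monom [intro!]: "c \<in> \<int> \<Longrightarrow> int_coeffs (monom c k)"
  and int_coeffs_pderiv [intro!]: "int_coeffs p \<Longrightarrow> int_coeffs (pderiv p)"
  by (auto simp: int_coeffs_def coeff_mult coeff_pderiv simp del: of_nat_Suc intro!: Ints_sum Ints_mult)

lemma int_coeffs_pCons [simp]: "int_coeffs (pCons c p) \<longleftrightarrow> c \<in> \<int> \<and> int_coeffs p"
  by (auto simp: int_coeffs_def coeff_pCons split: nat.splits)

lemma int_coeffs_power [intro!]: "int_coeffs p \<Longrightarrow> int_coeffs (p ^ k)"
  by (induction k) auto

lemma int_coeffs_sum [intro!]: "(\<And>x. x \<in> A \<Longrightarrow> int_coeffs (f x)) \<Longrightarrow> int_coeffs (\<Sum>x\<in>A. f x)"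
  by (induction A rule: infinite_finite_induct) auto

lemma int_coeffs_prod [intro!]: "(\<And>x. x \<in> A \<Longrightarrow> int_coeffs (f x)) \<Longrightarrow> int_coeffs (\<Prod>x\<in>A. f x)"
  by (induction A rule: infinite_finite_induct) auto

lemma int_coeffs_pcompose [intro!]: "int_coeffs p \<Longrightarrow> int_coeffs q \<Longrightarrow> int_coeffs (pcompose p q)"
  by (induction p) (auto simp: pcompose_pCons)

text \<open>Long division stays integral because the leading coefficient of \<open>b\<close> is 1:
  each step subtracts an integral multiple of \<open>b\<close>.\<close>

lemma monic_division:
  assumes "int_coeffs b" "lead_coeff b = 1" "int_coeffs a"
  shows "\<exists>q r. int_coeffs q \<and> int_coeffs r \<and> a = b * q + r \<and> (r = 0 \<or> degree r < degree b)"
  using assms(3)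
proof (induction "degree a" arbitrary: a rule: less_induct)
  case less
  show ?case
  proof (cases "a = 0 \<or> degree a < degree b")
    case True
    thus ?thesis using less.prems by (intro exI[of _ 0] exI[of _ a]) auto
  next
    case False
    define m where "m = monom (lead_coeff a) (degree a - degree b)"
    have "b \<noteq> 0" using assms(2) by auto
    have m: "int_coeffs m" using less.prems unfolding m_def by (auto intro: int_coeffsD)
    have deg: "degree (b * m) = degree a"
      using False \<open>b \<noteq> 0\<close> by (subst degree_mult_eq) (auto simp: m_def degree_monom_eq)
    have lc: "lead_coeff (b * m) = lead_coeff a"
      unfolding lead_coeff_mult assms(2) using False by (simp add: m_def degree_monom_eq)
    have lt: "a - b * m = 0 \<or> degree (a - b * m) < degree a"
    proof (cases "degree a = 0")
      case True
      have "coeff (a - b * m) 0 = 0" using lc deg True by simp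
      moreover have "degree (a - b * m) = 0" using True deg degree_diff_le[of a 0 "b * m"] by simp
      ultimately show ?thesis by (metis leading_coeff_0_iff)
    next
      case False
      have "degree (a - b * m) \<le> degree a" using deg degree_diff_le[of a "degree a" "b * m"] by simp
      moreover have "coeff (a - b * m) (degree a) = 0" using lc deg by simp
      ultimately show ?thesis
        by (metis le_neq_implies_less leading_coeff_0_iff)
    qed
    have ic: "int_coeffs (a - b * m)" using m assms less.prems by auto
    have "\<exists>q r. int_coeffs q \<and> int_coeffs r \<and> a - b * m = b * q + r \<and> (r = 0 \<or> degree r < degree b)"
      using lt less.hyps[OF _ ic] by force
    then obtain q r where "int_coeffs q" "int_coeffs r" "a - b * m = b * q + r"
      "r = 0 \<or> degree r < degree b" by blast
    thus ?thesis using m by (intro exI[of _ "q + m"] exI[of _ r]) (auto simp: algebra_simps)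
  qed
qed

text \<open>Division with remainder is unique over the complex numbers, so \<open>h\<close> must be
  the integral quotient supplied by \<open>monic_division\<close>.\<close>

lemma int_coeffs_monic_cancel:
  assumes "int_coeffs b" "lead_coeff b = 1" "int_coeffs (b * h)"
  shows "int_coeffs h"
proof -
  obtain q r where qr: "int_coeffs q" "b * h = b * q + r" "r = 0 \<or> degree r < degree b"
    using monic_division[OF assms] by blast
  have "b * (h - q) = r" using qr by (simp add: algebra_simps)
  moreover have "b \<noteq> 0" using assms(2) by auto
  ultimately have "h - q = 0"
    using qr(3) degree_mult_eq[of b "h - q"] by (cases "h = q") auto
  thus ?thesis using qr by simp
qed

lemma int_coeffs_iff_map_poly: "int_coeffs p \<longleftrightarrow> (\<exists>q. p = map_poly of_int q)"
proof
  assume p: "int_coeffs p"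
  have "p = map_poly of_int (map_poly (\<lambda>c. \<lfloor>Re c\<rfloor>) p)"
  proof (rule poly_eqI)
    fix i
    obtain k where "coeff p i = of_int k" using int_coeffsD[OF p, of i] by (auto elim: Ints_cases)
    thus "coeff p i = coeff (map_poly of_int (map_poly (\<lambda>c. \<lfloor>Re c\<rfloor>) p)) i"
      by (simp add: coeff_map_poly)
  qed
  thus "\<exists>q. p = map_poly of_int q" by blast
qed (auto simp: int_coeffs_def coeff_map_poly)

subsection \<open>Primitive roots of unity and cyclotomic polynomials\<close>

text \<open>For \<open>m = 0\<close> this is the infinite set of complex numbers that are not roots
  of unity, hence the recurring assumption \<open>m > 0\<close>.\<close>

definition prim_roots :: "nat \<Rightarrow> complex set" where
  "prim_roots m = {z. \<forall>k. z ^ k = 1 \<longleftrightarrow> m dvd k}"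

lemma prim_roots_power_eq_1_iff: "z \<in> prim_roots m \<Longrightarrow> z ^ k = 1 \<longleftrightarrow> m dvd k"
  by (simp add: prim_roots_def)

lemma prim_roots_unique: "z \<in> prim_roots m \<Longrightarrow> z \<in> prim_roots n \<Longrightarrow> m = n"
  by (metis dvd_antisym dvd_refl prim_roots_power_eq_1_iff)

lemma prim_roots_nonzero: "z \<in> prim_roots m \<Longrightarrow> m > 0 \<Longrightarrow> z \<noteq> 0"
  using prim_roots_power_eq_1_iff[of z m m] by (auto simp: power_0_left)

lemma norm_prim_roots: "z \<in> prim_roots m \<Longrightarrow> m > 0 \<Longrightarrow> norm z = 1"
  using prim_roots_power_eq_1_iff[of z m m] power_eq_1_iff[of z m] by auto

lemma ex_prim_roots:
  assumes "(z::complex) ^ n = 1" "n > 0"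
  shows "\<exists>d. d dvd n \<and> d > 0 \<and> z \<in> prim_roots d"
proof -
  define d where "d = (LEAST k. k > 0 \<and> z ^ k = 1)"
  have d: "d > 0" "z ^ d = 1"
    using LeastI[of "\<lambda>k. k > 0 \<and> z ^ k = 1" n] assms by (auto simp: d_def)
  have least: "d \<le> k" if "k > 0" "z ^ k = 1" for k
    unfolding d_def using that by (intro Least_le) auto
  have "z ^ k = 1 \<longleftrightarrow> d dvd k" for k
  proof -
    have "z ^ k = z ^ (d * (k div d) + k mod d)" by simp
    also have "\<dots> = z ^ (k mod d)" unfolding power_add power_mult by (simp add: d)
    finally have "z ^ k = z ^ (k mod d)" .
    moreover have "z ^ (k mod d) = 1 \<longleftrightarrow> k mod d = 0"
      using least[of "k mod d"] d(1) mod_less_divisor[of d k]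
      by (metis gr0I linorder_not_le power_0)
    ultimately show ?thesis by (simp add: dvd_eq_mod_eq_0)
  qed
  hence "z \<in> prim_roots d" by (simp add: prim_roots_def)
  moreover from this have "d dvd n" using assms by (simp add: prim_roots_power_eq_1_iff)
  ultimately show ?thesis using d by blast
qed

lemma roots_unity_eq_Union_prim_roots:
  assumes "n > 0"
  shows "{z. z ^ n = 1} = (\<Union>d\<in>{d. d dvd n}. prim_roots d)"
  using ex_prim_roots[OF _ assms] by (auto simp: prim_roots_power_eq_1_iff)

lemma finite_prim_roots [simp]: "m > 0 \<Longrightarrow> finite (prim_roots m)"
  by (rule finite_subset[OF _ finite_roots_unity[of m]]) (auto simp: prim_roots_power_eq_1_iff)

lemma prim_roots_disjoint: "m \<noteq> n \<Longrightarrow> prim_roots m \<inter> prim_roots n = {}"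
  using prim_roots_unique by blast

text \<open>Both sides have divisor sum \<open>m\<close>, since every \<open>m\<close>-th root of
  unity has exactly one order; strong induction then compares the terms for \<open>m\<close>
  itself.\<close>

lemma card_prim_roots: "m > 0 \<Longrightarrow> card (prim_roots m) = totient m"
proof (induction m rule: less_induct)
  case (less m)
  let ?D = "{d. d dvd m}"
  have fin: "finite ?D" using less.prems by simp
  have pos: "d > 0" if "d \<in> ?D" for d using that less.prems by (auto intro: Nat.gr0I)
  have "m = card {z::complex. z ^ m = 1}" using less.prems by (simp add: card_roots_unity_eq)
  also have "\<dots> = (\<Sum>d\<in>?D. card (prim_roots d))"
    unfolding roots_unity_eq_Union_prim_roots[OF less.prems]
    by (intro card_UN_disjoint ballI impI prim_roots_disjoint fin finite_prim_roots pos)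
  also have "\<dots> = card (prim_roots m) + (\<Sum>d\<in>?D - {m}. card (prim_roots d))"
    using fin by (intro sum.remove) auto
  also have "(\<Sum>d\<in>?D - {m}. card (prim_roots d)) = (\<Sum>d\<in>?D - {m}. totient d)"
    using pos less.prems by (intro sum.cong refl less.IH) (auto dest: dvd_imp_le)
  finally have "m = card (prim_roots m) + (\<Sum>d\<in>?D - {m}. totient d)" .
  moreover have "m = totient m + (\<Sum>d\<in>?D - {m}. totient d)"
    using totient_divisor_sum[of m] sum.remove[of ?D m totient] fin by simp
  ultimately show ?case by linarith
qed

lemma prim_roots_power:
  assumes "z \<in> prim_roots m" "coprime j m"
  shows "z ^ j \<in> prim_roots m"
  using assms by (auto simp: prim_roots_def power_mult [symmetric] coprime_dvd_mult_right_iff coprime_commute)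

lemma bij_betw_totatives_prim_roots:
  assumes "z \<in> prim_roots m" "m > 0"
  shows "bij_betw (\<lambda>j. z ^ j) (totatives m) (prim_roots m)"
proof -
  have *: "i = j" if "i \<in> totatives m" "j \<in> totatives m" "z ^ i = z ^ j" "i \<le> j" for i j
  proof -
    have "z ^ j = z ^ i * z ^ (j - i)" using that(4) by (metis le_add_diff_inverse power_add)
    hence "z ^ (j - i) = 1" using that prim_roots_nonzero[OF assms] by simp
    hence "m dvd j - i" using assms by (simp add: prim_roots_power_eq_1_iff)
    moreover have "j - i < m" using that by (auto simp: totatives_def)
    ultimately show ?thesis using that by (auto dest: nat_dvd_not_less)
  qed
  have inj: "inj_on (\<lambda>j. z ^ j) (totatives m)"
    by (intro inj_onI) (metis * nat_le_linear)
  moreover have "(\<lambda>j. z ^ j) ` totatives m = prim_roots m"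
  proof (rule card_subset_eq)
    show "(\<lambda>j. z ^ j) ` totatives m \<subseteq> prim_roots m"
      using assms by (auto intro!: prim_roots_power simp: totatives_def)
  qed (use inj assms in \<open>auto simp: card_image card_prim_roots totient_def\<close>)
  ultimately show ?thesis by (simp add: bij_betw_def)
qed

lemma bij_betw_prim_roots_power:
  assumes "coprime j m" "m > 0"
  shows "bij_betw (\<lambda>z. z ^ j) (prim_roots m) (prim_roots m)"
proof -
  obtain i where i: "[j * i = 1] (mod m)"
    by (metis One_nat_def assms(1) cong_solve_coprime_nat)
  have inv: "(z ^ j) ^ i = z" if "z \<in> prim_roots m" for z
  \<comment> \<open>Modulo 1 the residue of \<open>j * i\<close> is 0, so the rewriting of the
    exponent below requires \<open>m \<noteq> 1\<close>.\<close>
  proof (cases "m = 1")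
    case True
    thus ?thesis using that prim_roots_power_eq_1_iff[OF that, of 1] by simp
  next
    case False
    hence "j * i mod m = 1" using i assms by (simp add: cong_def)
    hence "(z ^ j) ^ i = z ^ (m * (j * i div m) + 1)"
      by (metis mult_div_mod_eq power_mult)
    also have "\<dots> = z"
      using that prim_roots_power_eq_1_iff[OF that, of m] by (simp add: power_add power_mult)
    finally show ?thesis .
  qed
  have "inj_on (\<lambda>z. z ^ j) (prim_roots m)" by (rule inj_on_inverseI) (rule inv)
  moreover from this have "(\<lambda>z. z ^ j) ` prim_roots m = prim_roots m"
    using assms by (intro card_subset_eq) (auto simp: card_image intro: prim_roots_power)
  ultimately show ?thesis by (simp add: bij_betw_def)
qed

section \<open>Cyclotomic polynomials as products over their roots\<close>

definition root_poly :: "complex set \<Rightarrow> complex poly" where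
  "root_poly S = (\<Prod>z\<in>S. [:-z, 1:])"

lemma root_poly_nonzero [simp]: "root_poly S \<noteq> 0"
  by (cases "finite S") (auto simp: root_poly_def)

lemma degree_root_poly [simp]: "degree (root_poly S) = card S"
  by (cases "finite S") (auto simp: root_poly_def degree_prod_eq_sum_degree)

lemma lead_coeff_root_poly [simp]: "lead_coeff (root_poly S) = 1"
  by (simp add: root_poly_def lead_coeff_prod del: degree_root_poly)

lemma poly_root_poly: "poly (root_poly S) x = (\<Prod>z\<in>S. x - z)"
  by (simp add: root_poly_def poly_prod)

lemma poly_root_poly_eq_0_iff: "finite S \<Longrightarrow> poly (root_poly S) x = 0 \<longleftrightarrow> x \<in> S"
  by (auto simp: poly_root_poly)

lemma monic_eq_root_poly:
  assumes "finite S" "lead_coeff p = 1" "degree p = card S" "\<And>z. z \<in> S \<Longrightarrow> poly p z = 0"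
  shows "p = root_poly S"
  by (rule poly_eqI_degree_lead_coeff[of _ "card S" _ S])
     (use assms lead_coeff_root_poly[of S] in \<open>auto simp: poly_root_poly_eq_0_iff\<close>)

definition cyclotomic :: "nat \<Rightarrow> complex poly" where
  "cyclotomic m = root_poly (prim_roots m)"

lemma cyclotomic_nonzero [simp]: "cyclotomic m \<noteq> 0"
  by (simp add: cyclotomic_def)

lemma lead_coeff_cyclotomic [simp]: "lead_coeff (cyclotomic m) = 1"
  using lead_coeff_root_poly[of "prim_roots m"] unfolding cyclotomic_def .

lemma degree_cyclotomic [simp]: "m > 0 \<Longrightarrow> degree (cyclotomic m) = totient m"
  by (simp add: cyclotomic_def card_prim_roots)

lemma poly_cyclotomic_eq_0_iff: "m > 0 \<Longrightarrow> poly (cyclotomic m) z = 0 \<longleftrightarrow> z \<in> prim_roots m"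
  by (simp add: cyclotomic_def poly_root_poly_eq_0_iff)

lemma root_poly_roots_unity:
  assumes "n > 0"
  shows "root_poly {z. z ^ n = 1} = monom 1 n - 1"
proof (rule monic_eq_root_poly[symmetric])
  have deg: "degree (monom 1 n - 1 :: complex poly) = n"
    using degree_add_eq_left[of "-1" "monom 1 n :: complex poly"] assms by (simp add: degree_monom_eq)
  thus "degree (monom 1 n - 1 :: complex poly) = card {z::complex. z ^ n = 1}"
    using assms by (simp add: card_roots_unity_eq)
  show "lead_coeff (monom 1 n - 1 :: complex poly) = 1"
    unfolding deg using assms by simp
qed (use assms in \<open>auto simp: finite_roots_unity poly_monom\<close>)

lemma prod_cyclotomic:
  assumes "n > 0"
  shows "(\<Prod>d\<in>{d. d dvd n}. cyclotomic d) = monom 1 n - 1"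
proof -
  have pos: "d > 0" if "d dvd n" for d using that assms by (auto intro: Nat.gr0I)
  have "(\<Prod>d\<in>{d. d dvd n}. cyclotomic d) = root_poly {z. z ^ n = 1}"
    unfolding roots_unity_eq_Union_prim_roots[OF assms] cyclotomic_def root_poly_def
    using assms by (intro prod.UNION_disjoint [symmetric] ballI impI prim_roots_disjoint finite_prim_roots)
      (auto simp: pos)
  thus ?thesis by (simp add: root_poly_roots_unity[OF assms])
qed

text \<open>What remains of \<open>monom 1 m - 1\<close> after dividing by the monic integral
  product over the proper divisors is again integral.\<close>

lemma int_coeffs_cyclotomic: "m > 0 \<Longrightarrow> int_coeffs (cyclotomic m)"
proof (induction m rule: less_induct)
  case (less m)
  let ?Q = "\<Prod>d\<in>{d. d dvd m} - {m}. cyclotomic d"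
  have pos: "d > 0" if "d dvd m" for d using that less.prems by (auto intro: Nat.gr0I)
  have "?Q * cyclotomic m = monom 1 m - 1"
    using prod_cyclotomic[OF less.prems] prod.remove[of "{d. d dvd m}" m cyclotomic] less.prems
    by (simp add: mult.commute)
  moreover have "int_coeffs ?Q"
    using pos less.prems by (intro int_coeffs_prod less.IH) (auto dest: dvd_imp_le)
  moreover have "lead_coeff ?Q = 1" by (simp add: lead_coeff_prod)
  moreover have "int_coeffs (monom 1 m - 1)" by (intro int_coeffs_diff int_coeffs_monom) auto
  ultimately show ?case
    using int_coeffs_monic_cancel[of ?Q "cyclotomic m"] by metis
qed

subsection \<open>Conjugates of roots of unity\<close>

lemma map_poly_of_int_mult:
  "map_poly of_int (p * q) = (map_poly of_int p * map_poly of_int q :: complex poly)"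
  by (rule poly_eqI) (simp add: coeff_map_poly coeff_mult)

lemma map_poly_of_int_add:
  "map_poly of_int (p + q) = (map_poly of_int p + map_poly of_int q :: complex poly)"
  by (rule poly_eqI) (simp add: coeff_map_poly)

lemma map_poly_of_int_smult:
  "map_poly of_int (smult c p) = (smult (of_int c) (map_poly of_int p) :: complex poly)"
  by (rule poly_eqI) (simp add: coeff_map_poly)

text \<open>A form of Gauss's lemma: passing to primitive parts removes the constant
  \<open>c\<close> up to a unit.\<close>

lemma primitive_dvd_smultD:
  fixes f g :: "int poly"
  assumes "content f = 1" "f dvd smult c g" "c \<noteq> 0"
  shows "f dvd g"
proof -
  have "primitive_part f dvd primitive_part (smult c g)"
    using assms(2) by (rule primitive_part_dvd_primitive_partI)
  moreover have "primitive_part f = f" by (simp add: primitive_part_prim assms(1))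
  moreover have "primitive_part (smult c g) = smult (unit_factor c) (primitive_part g)"
    using primitive_part_mult[of "[:c:]" g] by (simp add: primitive_part_const_poly)
  ultimately have "f dvd smult (unit_factor c) (primitive_part g)" by simp
  hence "f dvd smult (content g * unit_factor c) (smult (unit_factor c) (primitive_part g))"
    by (rule dvd_smult)
  also have "smult (content g * unit_factor c) (smult (unit_factor c) (primitive_part g)) =
      smult (unit_factor c * unit_factor c) (smult (content g) (primitive_part g))"
    by (simp add: mult_ac)
  also have "unit_factor c * unit_factor c = 1" using assms(3) by (simp add: sgn_if)
  finally show ?thesis by simp
qed

text \<open>A nonzero integer polynomial of least degree vanishing at \<alpha>, made primitive,
  divides all others by pseudo-division and Gauss's lemma. It divides the monic \<open>P\<close>, so
  its leading coefficient is 1 or -1, and a change of sign makes it monic.\<close>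

lemma ex_monic_min_poly:
  assumes P: "int_coeffs P" "lead_coeff P = 1" "poly P \<alpha> = 0"
  shows "\<exists>f. int_coeffs f \<and> lead_coeff f = 1 \<and> poly f \<alpha> = 0 \<and>
           (\<forall>F. int_coeffs F \<and> poly F \<alpha> = 0 \<longrightarrow> (\<exists>q. int_coeffs q \<and> F = f * q))"
proof -
  define ev where "ev = (\<lambda>p. poly (map_poly of_int p :: complex poly) \<alpha>)"
  have ev_mult: "ev (p * q) = ev p * ev q" and ev_add: "ev (p + q) = ev p + ev q"
    and ev_smult: "ev (smult c p) = of_int c * ev p" for p q c
    by (simp_all add: ev_def map_poly_of_int_mult map_poly_of_int_add map_poly_of_int_smult)
  obtain P' where P': "P = map_poly of_int P'" using P(1) int_coeffs_iff_map_poly by auto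
  have "P' \<noteq> 0" "ev P' = 0" using P P' by (auto simp: ev_def)
  define f0 where "f0 = arg_min degree (\<lambda>p. p \<noteq> 0 \<and> ev p = 0)"
  have f0: "f0 \<noteq> 0" "ev f0 = 0" and min: "degree f0 \<le> degree p" if "p \<noteq> 0" "ev p = 0" for p
    using arg_min_nat_lemma[of "\<lambda>p. p \<noteq> 0 \<and> ev p = 0" P' degree] \<open>P' \<noteq> 0\<close> \<open>ev P' = 0\<close> that
    by (auto simp: f0_def)
  have f0: "f0 \<noteq> 0" "ev f0 = 0" using f0[of P'] \<open>P' \<noteq> 0\<close> \<open>ev P' = 0\<close> by auto
  define f where "f = primitive_part f0"
  have f0_eq: "f0 = smult (content f0) f" by (simp add: f_def)
  have f: "f \<noteq> 0" "content f = 1" "degree f = degree f0" using f0 by (auto simp: f_def)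
  have evf: "ev f = 0"
    using ev_smult[of "content f0" f] f0 f0_eq by auto
  have dvd: "f dvd F" if "ev F = 0" for F
  proof -
    obtain q r where qr: "pseudo_divmod F f = (q, r)" by fastforce
    define c where "c = lead_coeff f ^ (Suc (degree F) - degree f)"
    have eq: "smult c F = f * q + r" and r: "r = 0 \<or> degree r < degree f"
      using pseudo_divmod[OF f(1) qr] by (auto simp: c_def)
    have "ev r = 0" using ev_mult[of f q] ev_add[of "f * q" r] ev_smult[of c F] eq evf that by simp
    hence "r = 0" using r min[of r] f(3) by fastforce
    hence "f dvd smult c F" using eq by simp
    moreover have "c \<noteq> 0" using f(1) by (simp add: c_def)
    ultimately show ?thesis using primitive_dvd_smultD f(2) by blast
  qed
  have "f dvd P'" using dvd \<open>ev P' = 0\<close> by blast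
  hence "lead_coeff f dvd lead_coeff P'" by (auto simp: lead_coeff_mult)
  moreover have "lead_coeff P' = 1"
    using P(2) unfolding P' by (simp add: coeff_map_poly degree_map_poly)
  ultimately have unit: "lead_coeff f * lead_coeff f = 1"
    by (auto simp: zdvd1_eq abs_if split: if_splits)
  define g where "g = smult (lead_coeff f) f"
  have "lead_coeff g = 1" using unit f(1) by (simp add: g_def)
  moreover have "ev g = 0" by (simp add: g_def ev_smult evf)
  moreover have "g dvd F" if F: "ev F = 0" for F
  proof -
    obtain q where "F = f * q" using dvd[OF F] by blast
    hence "F = g * smult (lead_coeff f) q" using unit by (simp add: g_def)
    thus ?thesis by (rule dvdI)
  qed
  ultimately show ?thesis
    by (intro exI[of _ "map_poly of_int g"])
       (auto simp: int_coeffs_iff_map_poly ev_def coeff_map_poly degree_map_poly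
          map_poly_of_int_mult elim!: dvdE, metis dvdE map_poly_of_int_mult)
qed

section \<open>Frobenius congruences modulo a prime\<close>

lemma Ints_fermat:
  assumes "prime p" "(a::complex) \<in> \<int>"
  shows "\<exists>b\<in>\<int>. a ^ p = a + of_nat p * b"
proof -
  obtain k where k: "a = of_int k" using assms(2) by (auto elim: Ints_cases)
  define a' where "a' = nat (k mod int p)"
  have p: "p > 0" using assms(1) prime_gt_0_nat by blast
  have "[a' ^ p = a'] (mod p)"
  proof (cases "p dvd a'")
    case True
    hence "p dvd a' ^ p" using p by (meson dvd_power dvd_trans)
    thus ?thesis using True by (simp add: cong_def mod_eq_0_iff_dvd)
  next
    case False
    from cong_mult[OF fermat_theorem[OF assms(1) False] cong_refl[of a']]
    show ?thesis using p by (simp add: power_eq_if mult.commute)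
  qed
  hence "[int a' ^ p = int a'] (mod int p)" by (metis cong_int_iff of_nat_power)
  moreover have "[int a' = k] (mod int p)" using p by (simp add: a'_def cong_def)
  ultimately have "[k ^ p = k] (mod int p)" by (meson cong_pow cong_sym cong_trans)
  then obtain b where "k ^ p = k + int p * b" by (metis cong_iff_lin cong_sym)
  hence "a ^ p = a + of_nat p * of_int b" unfolding k
    by (metis of_int_add of_int_mult of_int_of_nat_eq of_int_power)
  thus ?thesis using Ints_of_int by blast
qed

lemma freshman_int_coeffs:
  assumes "prime p" "int_coeffs u" "int_coeffs v"
  shows "\<exists>w. int_coeffs w \<and> (u + v) ^ p = u ^ p + v ^ p + smult (of_nat p) w"
proof -
  define w where "w = (\<Sum>k\<in>{1..<p}. of_nat ((p choose k) div p) * (u ^ k * v ^ (p - k)))"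
  have p: "p > 0" using assms(1) prime_gt_0_nat by blast
  have "(u + v) ^ p = (\<Sum>k\<le>p. of_nat (p choose k) * u ^ k * v ^ (p - k))"
    by (rule binomial_ring)
  also have "{..p} = insert 0 (insert p {1..<p})" using p by auto
  also have "(\<Sum>k\<in>\<dots>. of_nat (p choose k) * u ^ k * v ^ (p - k)) =
      v ^ p + u ^ p + (\<Sum>k\<in>{1..<p}. of_nat (p choose k) * u ^ k * v ^ (p - k))"
    using p by simp
  also have "(\<Sum>k\<in>{1..<p}. of_nat (p choose k) * u ^ k * v ^ (p - k)) = of_nat p * w"
    unfolding w_def sum_distrib_left
  proof (intro sum.cong refl)
    fix k assume "k \<in> {1..<p}"
    hence "p dvd (p choose k)" using assms(1) by (intro dvd_choose_prime) auto
    hence "p choose k = p * ((p choose k) div p)" by simp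
    hence "(of_nat (p choose k) :: complex poly) = of_nat p * of_nat ((p choose k) div p)"
      by (metis of_nat_mult)
    thus "of_nat (p choose k) * u ^ k * v ^ (p - k) =
        of_nat p * (of_nat ((p choose k) div p) * (u ^ k * v ^ (p - k)))"
      by (simp only: mult.assoc)
  qed
  finally have "(u + v) ^ p = u ^ p + v ^ p + smult (of_nat p) w"
    by (simp add: of_nat_poly algebra_simps)
  moreover have "int_coeffs w" using assms by (auto simp: w_def of_nat_poly)
  ultimately show ?thesis by blast
qed

text \<open>Coefficients are peeled off one at a time: the binomial theorem modulo \<open>p\<close>
  separates the constant term, and Fermat's theorem treats it.\<close>

lemma frobenius_int_coeffs:
  assumes "prime p" "int_coeffs g"
  shows "\<exists>k. int_coeffs k \<and> g ^ p = pcompose g (monom 1 p) + smult (of_nat p) k"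
  using assms(2)
proof (induction g)
  case 0
  thus ?case using assms(1) by (intro exI[of _ 0]) (simp add: zero_power prime_gt_0_nat)
next
  case (pCons a g)
  then obtain k where k: "int_coeffs k" "g ^ p = pcompose g (monom 1 p) + smult (of_nat p) k"
    by auto
  obtain b where b: "b \<in> \<int>" "a ^ p = a + of_nat p * b"
    using Ints_fermat[OF assms(1), of a] pCons.prems by auto
  obtain w where w: "int_coeffs w"
    "([:a:] + monom 1 1 * g) ^ p = [:a:] ^ p + (monom 1 1 * g) ^ p + smult (of_nat p) w"
    using freshman_int_coeffs[OF assms(1), of "[:a:]" "monom 1 1 * g"] pCons.prems
      int_coeffs_mult[OF int_coeffs_monom[OF Ints_1, of 1], of g] by auto
  have "pCons a g = [:a:] + monom 1 1 * g" by (simp add: monom_altdef)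
  hence "pCons a g ^ p = [:a ^ p:] + monom 1 p * g ^ p + smult (of_nat p) w"
    using w by (simp add: poly_const_pow power_mult_distrib monom_power)
  also have "\<dots> = pcompose (pCons a g) (monom 1 p) + smult (of_nat p) ([:b:] + monom 1 p * k + w)"
    by (simp add: b k pcompose_pCons smult_add_right algebra_simps)
  finally show ?case using b k w by (intro exI[of _ "[:b:] + monom 1 p * k + w"]) auto
qed

text \<open>Differentiating \<open>x\<^sup>m - 1 = f g\<close> at a root \<open>\<alpha>\<close> of the minimal polynomial \<open>f\<close> shows that \<open>g(\<alpha>)\<close>
  divides \<open>m\<close> in \<open>\<int>[\<alpha>]\<close>; if \<open>\<alpha>\<^sup>p\<close> were a root of \<open>g\<close>, then \<open>p\<close> would divide
  \<open>g(\<alpha>)\<^sup>p\<close> and hence \<open>m\<^sup>p\<close>.\<close>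
lemma poly_prime_power_eq_0:
  assumes F: "int_coeffs F" "poly F \<alpha> = 0" and \<alpha>: "\<alpha> ^ m = 1" "m > 0"
    and p: "prime p" "\<not> p dvd m"
  shows "poly F (\<alpha> ^ p) = 0"
proof -
  let ?P = "monom 1 m - 1 :: complex poly"
  have P: "int_coeffs ?P" by (intro int_coeffs_diff int_coeffs_monom) auto
  have deg: "degree ?P = m"
    using degree_add_eq_left[of "-1" "monom 1 m :: complex poly"] \<alpha> by (simp add: degree_monom_eq)
  have "lead_coeff ?P = 1" unfolding deg using \<alpha> by simp
  moreover have P0: "poly ?P \<alpha> = 0" using \<alpha> by (simp add: poly_monom)
  ultimately obtain f where f: "int_coeffs f" "lead_coeff f = 1" "poly f \<alpha> = 0"
    and min: "\<And>F. int_coeffs F \<Longrightarrow> poly F \<alpha> = 0 \<Longrightarrow> \<exists>q. int_coeffs q \<and> F = f * q"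
    using ex_monic_min_poly[OF P, of \<alpha>] by blast
  obtain g where g: "int_coeffs g" "?P = f * g" using min[OF P P0] by blast
  have "poly f (\<alpha> ^ p) = 0"
  proof (rule ccontr)
    assume nz: "poly f (\<alpha> ^ p) \<noteq> 0"
    have "poly ?P (\<alpha> ^ p) = 0"
      using \<alpha> by (simp add: poly_monom flip: power_mult) (simp add: mult.commute power_mult)
    hence g0: "poly g (\<alpha> ^ p) = 0" using g nz by simp
    obtain k where k: "int_coeffs k" "g ^ p = pcompose g (monom 1 p) + smult (of_nat p) k"
      using frobenius_int_coeffs[OF p(1) g(1)] by blast
    have gp: "poly g \<alpha> ^ p = of_nat p * poly k \<alpha>"
      using arg_cong[OF k(2), of "\<lambda>q. poly q \<alpha>"] g0
      by (simp add: poly_power poly_pcompose poly_monom)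
    have "poly (pderiv ?P) \<alpha> = poly (pderiv (f * g)) \<alpha>" using g by simp
    hence "of_nat m * \<alpha> ^ (m - 1) = poly (pderiv f) \<alpha> * poly g \<alpha>"
      by (simp add: pderiv_diff pderiv_monom poly_monom pderiv_mult f pderiv_1)
    hence "\<alpha> * (of_nat m * \<alpha> ^ (m - 1)) = \<alpha> * (poly (pderiv f) \<alpha> * poly g \<alpha>)" by simp
    moreover have "\<alpha> * \<alpha> ^ (m - 1) = 1" using \<alpha> by (simp add: power_eq_if)
    moreover have "\<alpha> * (of_nat m * \<alpha> ^ (m - 1)) = of_nat m * (\<alpha> * \<alpha> ^ (m - 1))"
      by (rule mult.left_commute)
    ultimately have "of_nat m = \<alpha> * poly (pderiv f) \<alpha> * poly g \<alpha>"
      by (metis mult.assoc mult.right_neutral)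
    hence "of_nat m ^ p = (\<alpha> * poly (pderiv f) \<alpha>) ^ p * poly g \<alpha> ^ p"
      by (simp add: power_mult_distrib)
    also have "\<dots> = of_nat p * poly ((monom 1 1 * pderiv f) ^ p * k) \<alpha>"
      unfolding gp by (simp add: poly_power poly_monom)
    finally have mp: "of_nat m ^ p = of_nat p * poly ((monom 1 1 * pderiv f) ^ p * k) \<alpha>" .
    \<comment> \<open>Divisibility by \<open>p\<close> is brought down to the integers: with the
      cofactor reduced modulo \<open>f\<close>, the polynomial \<open>s\<close> vanishes at \<alpha>
      and has smaller degree than \<open>f\<close>. Hence \<open>s = 0\<close>, and its constant
      coefficient shows that \<open>p\<close> divides \<open>m ^ p\<close>.\<close>
    have "int_coeffs ((monom 1 1 * pderiv f) ^ p * k)" using f k by auto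
    then obtain q r where qr: "int_coeffs r" "(monom 1 1 * pderiv f) ^ p * k = f * q + r"
      "r = 0 \<or> degree r < degree f"
      using monic_division[OF f(1,2)] by blast
    define s where "s = [:of_nat m ^ p:] - smult (of_nat p) r"
    have "int_coeffs s" using qr by (auto simp: s_def)
    moreover have "poly s \<alpha> = 0" using mp unfolding qr(2) by (simp add: s_def f)
    ultimately obtain q' where q': "s = f * q'" using min by blast
    have "degree f \<noteq> 0"
    proof
      assume "degree f = 0"
      then obtain c where "f = [:c:]" by (rule degree_eq_zeroE)
      thus False using f(2,3) by simp
    qed
    hence "degree s < degree f"
      unfolding s_def using qr(3) degree_smult_le[of "of_nat p" r]
      by (intro degree_diff_less) auto
    hence "s = 0" using q' degree_mult_eq[of f q'] by (cases "q' = 0") auto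
    hence "coeff s 0 = 0" by simp
    hence "of_nat m ^ p = of_nat p * coeff r 0" by (simp add: s_def)
    moreover obtain c where "coeff r 0 = of_int c" using int_coeffsD[OF qr(1), of 0] by (auto elim: Ints_cases)
    ultimately have "(of_int (int m ^ p) :: complex) = of_int (int p * c)" by simp
    hence "int m ^ p = int p * c" unfolding of_int_eq_iff .
    hence "int p dvd int m ^ p" by simp
    hence "p dvd m ^ p" by (metis int_dvd_int_iff of_nat_power)
    thus False using p prime_dvd_power by blast
  qed
  moreover obtain q where "F = f * q" using min F by blast
  ultimately show ?thesis by simp
qed

text \<open>The prime factors of \<open>j\<close> are applied one after another, with
  \<open>\<alpha> ^ p\<close> taking the place of \<alpha>.\<close>

lemma poly_coprime_power_eq_0:
  assumes "int_coeffs F" "poly F \<alpha> = 0" "\<alpha> ^ m = 1" "m > 0" "coprime j m"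
  shows "poly F (\<alpha> ^ j) = 0"
  using assms(2,3,5)
proof (induction j arbitrary: \<alpha> rule: prime_divisors_induct)
  case zero
  hence "m = 1" by simp
  thus ?case using zero by simp
next
  case (unit j)
  thus ?case by simp
next
  case (factor p j)
  have "\<not> p dvd m"
    using factor by (metis coprime_common_divisor dvd_triv_left not_prime_unit)
  hence "poly F (\<alpha> ^ p) = 0"
    using factor assms by (intro poly_prime_power_eq_0[of F \<alpha> m]) auto
  moreover have "(\<alpha> ^ p) ^ m = 1" using factor by (metis mult.commute power_mult power_one)
  ultimately have "poly F ((\<alpha> ^ p) ^ j) = 0" using factor by simp
  thus ?case by (simp add: power_mult)
qed

lemma poly_prim_roots_eq_0:
  assumes "int_coeffs F" "poly F z = 0" "z \<in> prim_roots m" "w \<in> prim_roots m" "m > 0"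
  shows "poly F w = 0"
proof -
  obtain j where "j \<in> totatives m" "w = z ^ j"
    using bij_betw_totatives_prim_roots[OF assms(3,5)] assms(4) by (auto simp: bij_betw_def)
  thus ?thesis
    using poly_coprime_power_eq_0[OF assms(1,2), of m j] assms(5) prim_roots_power_eq_1_iff[OF assms(3)]
    by (auto simp: totatives_def)
qed

text \<open>One primitive root as a zero forces all of them, so a nonzero remainder modulo
  \<open>cyclotomic m\<close> would have more zeros than its degree allows.\<close>

lemma cyclotomic_factor:
  assumes "int_coeffs F" "poly F z = 0" "z \<in> prim_roots m" "m > 0"
  shows "\<exists>q. int_coeffs q \<and> F = cyclotomic m * q"
proof -
  obtain q r where qr: "int_coeffs q" "int_coeffs r" "F = cyclotomic m * q + r"
    "r = 0 \<or> degree r < degree (cyclotomic m)"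
    using monic_division[OF int_coeffs_cyclotomic lead_coeff_cyclotomic assms(1)] assms by blast
  have "poly r w = 0" if "w \<in> prim_roots m" for w
    using poly_prim_roots_eq_0[OF assms(1-3) that] assms(4) that poly_cyclotomic_eq_0_iff[of m w]
    by (simp add: qr(3))
  hence "r = 0"
    using qr(4) assms(4) poly_eqI_degree[of "prim_roots m" r 0] by (auto simp: card_prim_roots)
  thus ?thesis using qr by auto
qed

subsection \<open>Norms over primitive roots of unity\<close>

text \<open>For integral \<open>p\<close> this is the absolute value of the norm, from the
  \<open>m\<close>-th cyclotomic field to the rationals, of the value of \<open>p\<close> at a
  primitive root.\<close>

definition cyc_norm :: "nat \<Rightarrow> complex poly \<Rightarrow> real" where
  "cyc_norm m p = (\<Prod>z\<in>prim_roots m. norm (poly p z))"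

lemma cyc_norm_mult: "cyc_norm m (p * q) = cyc_norm m p * cyc_norm m q"
  by (simp add: cyc_norm_def norm_mult prod.distrib)

lemma cyc_norm_1 [simp]: "cyc_norm m 1 = 1"
  by (simp add: cyc_norm_def)

lemma cyc_norm_nonneg [simp]: "cyc_norm m p \<ge> 0"
  by (simp add: cyc_norm_def prod_nonneg)

text \<open>With \<open>u(x) = \<Prod>\<^sub>j p(x\<^sup>j)\<close>, the remainder of \<open>u\<close> modulo the cyclotomic polynomial
  has integer coefficients and takes the value \<open>\<Prod>\<^sub>z p(z)\<close> at all primitive roots, so it is constant.\<close>
lemma prod_prim_roots_in_Ints:
  assumes "int_coeffs p" "m > 0"
  shows "(\<Prod>z\<in>prim_roots m. poly p z) \<in> \<int>"
proof -
  define u where "u = (\<Prod>j\<in>totatives m. pcompose p (monom 1 j))"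
  let ?N = "\<Prod>z\<in>prim_roots m. poly p z"
  have "int_coeffs u" using assms by (auto simp: u_def)
  then obtain q r where qr: "int_coeffs r" "u = cyclotomic m * q + r"
      "r = 0 \<or> degree r < degree (cyclotomic m)"
    using monic_division[OF int_coeffs_cyclotomic lead_coeff_cyclotomic] assms by blast
  have "poly r z = poly [:?N:] z" if "z \<in> prim_roots m" for z
  proof -
    have "poly r z = poly u z"
      using poly_cyclotomic_eq_0_iff[of m z] assms that by (simp add: qr(2))
    also have "\<dots> = (\<Prod>j\<in>totatives m. poly p (z ^ j))"
      by (simp add: u_def poly_prod poly_pcompose poly_monom)
    also have "\<dots> = ?N"
      by (rule prod.reindex_bij_betw[OF bij_betw_totatives_prim_roots[OF that assms(2)]])
    finally show ?thesis by simp
  qed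
  moreover have "totient m > 0" using assms by simp
  ultimately have "r = [:?N:]"
    using qr(3) assms by (intro poly_eqI_degree[of "prim_roots m"]) (auto simp: card_prim_roots)
  thus ?thesis using qr(1) by simp
qed

lemma cyc_norm_ge_1:
  assumes "int_coeffs p" "m > 0" "\<And>z. z \<in> prim_roots m \<Longrightarrow> poly p z \<noteq> 0"
  shows "cyc_norm m p \<ge> 1"
proof -
  obtain k where k: "(\<Prod>z\<in>prim_roots m. poly p z) = of_int k"
    using prod_prim_roots_in_Ints[OF assms(1,2)] by (auto elim: Ints_cases)
  have "(\<Prod>z\<in>prim_roots m. poly p z) \<noteq> 0" using assms by simp
  hence "k \<noteq> 0" using k by auto
  hence "\<bar>k\<bar> \<ge> 1" by linarith
  moreover have "cyc_norm m p = norm (of_int k :: complex)"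
    by (simp add: cyc_norm_def prod_norm k)
  ultimately show ?thesis by simp
qed

lemma prim_roots_power_prime_power:
  assumes "z \<in> prim_roots (m * p ^ j)" "j \<le> a" "coprime p m"
  shows "z ^ p ^ a \<in> prim_roots m"
proof -
  have "m * p ^ j dvd p ^ a * k \<longleftrightarrow> m dvd k" for k
  proof
    assume "m * p ^ j dvd p ^ a * k"
    hence "m dvd p ^ a * k" by (rule dvd_mult_left)
    thus "m dvd k" using assms(3) by (simp add: coprime_dvd_mult_right_iff coprime_commute)
  next
    assume "m dvd k"
    thus "m * p ^ j dvd p ^ a * k"
      using assms(2) by (subst mult.commute) (intro mult_dvd_mono le_imp_power_dvd)
  qed
  thus ?thesis
    using assms(1) by (simp add: prim_roots_def flip: power_mult)
qed

text \<open>Raising to the power \<open>p ^ a\<close> sends each root of the right side to a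
  primitive \<open>m\<close>-th root. The totients of the \<open>m * p ^ j\<close> add up to the
  degree of the left side, so it has no further roots.\<close>

lemma cyclotomic_prime_power_compose:
  assumes "prime p" "\<not> p dvd m" "m > 0"
  shows "pcompose (cyclotomic m) (monom 1 (p ^ a)) = (\<Prod>j\<le>a. cyclotomic (m * p ^ j))"
proof -
  define S where "S = (\<Union>j\<in>{..a}. prim_roots (m * p ^ j))"
  have cop: "coprime p m" using assms by (simp add: prime_imp_coprime)
  have p: "p > 1" using assms(1) prime_gt_1_nat by blast
  have ne: "m * p ^ i \<noteq> m * p ^ j" if "i \<noteq> j" for i j using assms(3) p that by simp
  have pos: "m * p ^ j > 0" for j using assms(3) p by simp
  have tot: "(\<Sum>j\<le>a. totient (m * p ^ j)) = totient m * p ^ a"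
  proof (induction a)
    case (Suc a)
    have "coprime m (p ^ Suc a)" using cop by (simp add: coprime_commute)
    hence "totient (m * p ^ Suc a) = totient m * ((p - 1) * p ^ a)"
      using totient_prime_power_Suc[OF assms(1), of a] by (simp add: totient_mult_coprime mult_ac)
    also have "\<dots> = totient m * p ^ Suc a - totient m * p ^ a"
      by (simp add: algebra_simps diff_mult_distrib)
    finally have "totient (m * p ^ Suc a) = totient m * p ^ Suc a - totient m * p ^ a" .
    moreover have "totient m * p ^ a \<le> totient m * p ^ Suc a" using p by simp
    ultimately show ?case using Suc.IH by (simp del: power_Suc)
  qed auto
  have "card S = (\<Sum>j\<le>a. card (prim_roots (m * p ^ j)))"
    unfolding S_def
    by (intro card_UN_disjoint ballI impI prim_roots_disjoint finite_prim_roots pos ne) auto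
  hence card: "card S = totient m * p ^ a" by (simp only: card_prim_roots[OF pos] tot)
  have deg: "degree (pcompose (cyclotomic m) (monom 1 (p ^ a))) = totient m * p ^ a"
    using assms(3) by (simp add: degree_pcompose degree_monom_eq)
  have "pcompose (cyclotomic m) (monom 1 (p ^ a)) = root_poly S"
  proof (rule monic_eq_root_poly)
    show "finite S" unfolding S_def by (intro finite_UN_I finite_prim_roots pos) auto
    show "degree (pcompose (cyclotomic m) (monom 1 (p ^ a))) = card S" by (simp add: deg card)
    show "lead_coeff (pcompose (cyclotomic m) (monom 1 (p ^ a))) = 1"
      using lead_coeff_comp[of "monom 1 (p ^ a) :: complex poly" "cyclotomic m"] p
      by (simp add: degree_monom_eq)
    fix z assume "z \<in> S"
    then obtain j where "j \<le> a" "z \<in> prim_roots (m * p ^ j)" by (auto simp: S_def)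
    hence "z ^ p ^ a \<in> prim_roots m"
      using prim_roots_power_prime_power[OF _ _ cop] by blast
    thus "poly (pcompose (cyclotomic m) (monom 1 (p ^ a))) z = 0"
      using assms(3) by (simp add: poly_pcompose poly_monom poly_cyclotomic_eq_0_iff)
  qed
  also have "\<dots> = (\<Prod>j\<le>a. cyclotomic (m * p ^ j))"
    unfolding S_def root_poly_def cyclotomic_def
    by (intro prod.UNION_disjoint ballI impI prim_roots_disjoint finite_prim_roots pos ne) auto
  finally show ?thesis .
qed

lemma pderiv_cyclotomic_nonzero:
  assumes "z \<in> prim_roots m" "m > 0"
  shows "poly (pderiv (cyclotomic m)) z \<noteq> 0"
proof -
  have "cyclotomic m = [:-z, 1:] * root_poly (prim_roots m - {z})"
    unfolding cyclotomic_def root_poly_def using assms by (intro prod.remove) auto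
  moreover have "poly (root_poly (prim_roots m - {z})) z \<noteq> 0"
    using assms by (simp add: poly_root_poly_eq_0_iff)
  ultimately show ?thesis by (simp add: pderiv_mult pderiv_pCons del: mult_pCons_left)
qed

text \<open>The polynomials \<open>\<Phi>\<^sub>m(x\<^sup>q)\<close> with \<open>q = p\<^sup>a\<close> and \<open>q = p\<^sup>a\<^sup>-\<^sup>1\<close> have quotient \<open>\<Phi>\<^sub>m\<^sub>q\<close>
  and simple zeros at the primitive \<open>m\<close>-th roots \<open>z\<close>. Comparing derivatives evaluates
  the quotient at \<open>z\<close>, and the factors \<open>\<Phi>\<^sub>m'(z\<^sup>q)\<close> cancel because \<open>z \<mapsto> z\<^sup>q\<close> is a permutation.\<close>
lemma cyc_norm_cyclotomic_prime_power:
  assumes "prime p" "\<not> p dvd m" "m > 0" "a > 0"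
  shows "cyc_norm m (cyclotomic (m * p ^ a)) = real p ^ totient m"
proof -
  define f where "f = (\<lambda>b. pcompose (cyclotomic m) (monom 1 (p ^ b)))"
  define D where "D = (\<Prod>z\<in>prim_roots m. norm (poly (pderiv (cyclotomic m)) z))"
  have cop: "coprime p m" using assms by (simp add: prime_imp_coprime)
  have p: "p > 0" using assms(1) prime_gt_0_nat by blast
  have nD: "(\<Prod>z\<in>prim_roots m. norm (poly (pderiv (f b)) z)) = real p ^ (b * totient m) * D" for b
  proof -
    have "(\<Prod>z\<in>prim_roots m. norm (poly (pderiv (f b)) z)) =
          (\<Prod>z\<in>prim_roots m. real (p ^ b) * norm (poly (pderiv (cyclotomic m)) (z ^ p ^ b)))"
    proof (intro prod.cong refl)
      fix z assume "z \<in> prim_roots m"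
      hence "norm z = 1" using norm_prim_roots assms by blast
      thus "norm (poly (pderiv (f b)) z) = real (p ^ b) * norm (poly (pderiv (cyclotomic m)) (z ^ p ^ b))"
        by (simp add: f_def pderiv_pcompose poly_pcompose poly_monom pderiv_monom norm_mult norm_power)
    qed
    also have "\<dots> = real (p ^ b) ^ totient m * (\<Prod>z\<in>prim_roots m. norm (poly (pderiv (cyclotomic m)) (z ^ p ^ b)))"
      using assms by (simp add: prod.distrib card_prim_roots)
    also have "(\<Prod>z\<in>prim_roots m. norm (poly (pderiv (cyclotomic m)) (z ^ p ^ b))) = D"
      unfolding D_def using cop assms
      by (intro prod.reindex_bij_betw[where g = "\<lambda>z. norm (poly (pderiv (cyclotomic m)) z)"]
           bij_betw_prim_roots_power) auto
    finally show ?thesis by (simp add: power_mult)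
  qed
  have "D \<noteq> 0" using assms by (auto simp: D_def pderiv_cyclotomic_nonzero)
  obtain b where b: "a = Suc b" using assms by (cases a) auto
  have eq: "f a = cyclotomic (m * p ^ a) * f b"
    unfolding f_def b cyclotomic_prime_power_compose[OF assms(1-3)]
    by (simp add: mult.commute del: power_Suc)
  have fb: "poly (f b) z = 0" if "z \<in> prim_roots m" for z
    using prim_roots_power[OF that, of "p ^ b"] cop assms
    by (simp add: f_def poly_pcompose poly_monom poly_cyclotomic_eq_0_iff)
  have "real p ^ (a * totient m) * D = (\<Prod>z\<in>prim_roots m. norm (poly (pderiv (f a)) z))"
    by (simp add: nD)
  also have "\<dots> = (\<Prod>z\<in>prim_roots m. norm (poly (cyclotomic (m * p ^ a)) z) * norm (poly (pderiv (f b)) z))"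
    unfolding eq by (intro prod.cong refl) (simp add: pderiv_mult fb norm_mult)
  also have "\<dots> = cyc_norm m (cyclotomic (m * p ^ a)) * (real p ^ (b * totient m) * D)"
    by (simp add: prod.distrib cyc_norm_def nD)
  finally show ?thesis
    using \<open>D \<noteq> 0\<close> p by (simp add: b power_add)
qed

subsection \<open>Cyclotomic factors of a polynomial with small coefficients\<close>

text \<open>Since \<open>K\<close> vanishes at no root of unity, \<open>count M d\<close> is the
  exact multiplicity of \<open>cyclotomic d\<close> in \<open>F\<close> for
  \<open>d > 0\<close>.\<close>

lemma ex_cyclotomic_factorization:
  assumes "int_coeffs F" "F \<noteq> 0"
  shows "\<exists>M K. 0 \<notin># M \<and> int_coeffs K \<and> F = (\<Prod>d\<in>#M. cyclotomic d) * K \<and>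
           (\<forall>d>0. \<forall>z\<in>prim_roots d. poly K z \<noteq> 0)"
  using assms
proof (induction "degree F" arbitrary: F rule: less_induct)
  case less
  show ?case
  proof (cases "\<exists>d>0. \<exists>z\<in>prim_roots d. poly F z = 0")
    case False
    hence "\<forall>d>0. \<forall>z\<in>prim_roots d. poly F z \<noteq> 0" by blast
    thus ?thesis using less.prems by (intro exI[of _ "{#}"] exI[of _ F]) simp
  next
    case True
    then obtain d z where d: "d > 0" "z \<in> prim_roots d" "poly F z = 0" by blast
    then obtain q where q: "int_coeffs q" "F = cyclotomic d * q"
      using cyclotomic_factor less.prems by blast
    have "q \<noteq> 0" using q less.prems by auto
    hence "degree F = totient d + degree q" using q d by (simp add: degree_mult_eq)
    moreover have "totient d > 0" using d by simp
    ultimately have "degree q < degree F" by linarith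
    from less.hyps[OF this q(1) \<open>q \<noteq> 0\<close>] obtain M K where "0 \<notin># M" "int_coeffs K"
      "q = (\<Prod>d\<in>#M. cyclotomic d) * K" "\<forall>d>0. \<forall>z\<in>prim_roots d. poly K z \<noteq> 0" by blast
    thus ?thesis using q d by (intro exI[of _ "add_mset d M"] exI[of _ K]) (auto simp: mult_ac)
  qed
qed

text \<open>Each differentiation removes one factor \<open>[:-z, 1:]\<close>, multiplies the value
  of the cofactor at \<open>z\<close> by the exponent, which is at least 1, and multiplies the sum
  of the absolute coefficients by at most \<open>n\<close>.\<close>

lemma norm_poly_cofactor_le:
  fixes F G :: "complex poly"
  assumes "F = [:-z, 1:] ^ r * G" "norm z = 1" "degree F \<le> n"
  shows "norm (poly G z) \<le> real n ^ r * (\<Sum>i\<le>n. norm (coeff F i))"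
  using assms(1,3)
proof (induction r arbitrary: F G)
  case 0
  have "poly F z = (\<Sum>i\<le>n. coeff F i * z ^ i)"
    unfolding poly_altdef using 0(2) by (intro sum.mono_neutral_left) (auto simp: coeff_eq_0)
  also have "norm \<dots> \<le> (\<Sum>i\<le>n. norm (coeff F i * z ^ i))" by (rule norm_sum)
  finally show ?case using 0 assms(2) by (simp add: norm_mult norm_power)
next
  case (Suc r)
  define G' where "G' = smult (of_nat (Suc r)) G + [:-z, 1:] * pderiv G"
  have "pderiv F = [:-z, 1:] ^ r * G'"
    unfolding Suc.prems(1) G'_def
    by (simp add: pderiv_mult pderiv_power_Suc pderiv_pCons algebra_simps del: power_Suc) (simp add: algebra_simps)
  moreover have "degree (pderiv F) \<le> n" using Suc.prems(2) by (simp add: degree_pderiv)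
  ultimately have G': "norm (poly G' z) \<le> real n ^ r * (\<Sum>i\<le>n. norm (coeff (pderiv F) i))"
    by (rule Suc.IH)
  have "(\<Sum>i\<le>n. norm (coeff (pderiv F) i)) \<le> real n * (\<Sum>i\<le>n. norm (coeff F i))"
  proof -
    have top: "coeff F (Suc n) = 0" using Suc.prems(2) by (intro coeff_eq_0) auto
    have "(\<Sum>i\<le>n. norm (coeff (pderiv F) i)) = (\<Sum>i\<le>n. real (Suc i) * norm (coeff F (Suc i)))"
      by (simp add: coeff_pderiv norm_mult del: of_nat_Suc)
    also have "\<dots> \<le> (\<Sum>i\<le>n. real n * norm (coeff F (Suc i)))"
    proof (rule sum_mono)
      fix i assume "i \<in> {..n}"
      \<comment> \<open>For \<open>i = n\<close> the factor \<open>Suc i\<close> exceeds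
        \<open>n\<close>, but the coefficient there vanishes.\<close>
      hence "i = n \<or> Suc i \<le> n" by auto
      thus "real (Suc i) * norm (coeff F (Suc i)) \<le> real n * norm (coeff F (Suc i))"
        using top by (elim disjE) (simp, intro mult_right_mono, simp_all)
    qed
    also have "\<dots> = real n * (\<Sum>i\<in>Suc ` {..n}. norm (coeff F i))"
      by (simp add: sum.reindex sum_distrib_left)
    also have "(\<Sum>i\<in>Suc ` {..n}. norm (coeff F i)) = (\<Sum>i\<in>Suc ` {..<n}. norm (coeff F i))"
      using top by (intro sum.mono_neutral_right) (auto simp: image_iff le_less)
    also have "\<dots> \<le> (\<Sum>i\<le>n. norm (coeff F i))"
      by (intro sum_mono2) auto
    finally show ?thesis by (simp add: mult_left_mono)
  qed
  from mult_left_mono[OF this, of "real n ^ r"]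
  have "real n ^ r * (\<Sum>i\<le>n. norm (coeff (pderiv F) i)) \<le> real n ^ Suc r * (\<Sum>i\<le>n. norm (coeff F i))"
    by (simp add: mult_ac)
  with G' have "norm (poly G' z) \<le> real n ^ Suc r * (\<Sum>i\<le>n. norm (coeff F i))"
    by linarith
  moreover have "norm (poly G' z) = real (Suc r) * norm (poly G z)"
    by (simp add: G'_def norm_mult del: of_nat_Suc)
  moreover have "norm (poly G z) \<le> real (Suc r) * norm (poly G z)"
    by (simp add: mult_le_cancel_right1)
  ultimately show ?case by linarith
qed

text \<open>Dividing out \<open>\<Phi>\<^sub>m\<^sup>r\<close> at its roots costs a factor \<open>n\<^sup>r\<close>, while each factor
  \<open>\<Phi>\<^sub>m\<^sub>q\<close> contributes \<open>p\<close> per root to the norm of the cofactor.\<close>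
lemma cyclotomic_multiplicity_bound:
  fixes c :: real
  assumes F: "F = (\<Prod>d\<in>#M. cyclotomic d) * K" "0 \<notin># M" "int_coeffs K"
      "\<forall>d>0. \<forall>z\<in>prim_roots d. poly K z \<noteq> 0"
    and deg: "degree F \<le> n" and n: "n > 0"
    and sum: "(\<Sum>i\<le>n. norm (coeff F i)) \<le> S" "S > 0"
    and m: "m > 0"
    and Q: "finite Q" "\<And>p a. (p, a) \<in> Q \<Longrightarrow> prime p \<and> \<not> p dvd m \<and> a > 0"
  shows "(\<Sum>(p, a)\<in>Q. real (count M (m * p ^ a)) * ln (real p)) \<le> real (count M m) * ln (real n) + ln S"
proof -
  define r where "r = count M m"
  define R where "R = filter_mset (\<lambda>d. d \<noteq> m) M"
  define G where "G = (\<Prod>d\<in>#R. cyclotomic d) * K"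
  have "M = replicate_mset r m + R"
    by (rule multiset_eqI) (auto simp: r_def R_def)
  hence FG: "F = cyclotomic m ^ r * G"
    by (simp add: F(1) G_def mult_ac)
  have posR: "d > 0" if "d \<in># R" for d using F(2) that by (auto simp: R_def intro: Nat.gr0I)
  have tot: "totient m > 0" using m by simp

  \<comment> \<open>With \<open>H\<close> the cofactor of the linear factor at \<open>z\<close>,
    \<open>F\<close> is \<open>[:-z, 1:] ^ r\<close> times \<open>H ^ r * G\<close>, and
    \<open>H\<close> takes at \<open>z\<close> the value of the derivative of
    \<open>cyclotomic m\<close>.\<close>
  have le: "norm (poly (pderiv (cyclotomic m)) z) ^ r * norm (poly G z) \<le> real n ^ r * S"
    if z: "z \<in> prim_roots m" for z
  proof -
    define H where "H = root_poly (prim_roots m - {z})"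
    have eq: "cyclotomic m = [:-z, 1:] * H"
      unfolding cyclotomic_def root_poly_def H_def using z m by (intro prod.remove) auto
    have "poly (pderiv (cyclotomic m)) z = poly H z"
      unfolding eq by (simp add: pderiv_mult pderiv_pCons del: mult_pCons_left)
    moreover have "norm (poly (H ^ r * G) z) \<le> real n ^ r * (\<Sum>i\<le>n. norm (coeff F i))"
      using deg norm_prim_roots[OF z m]
      by (intro norm_poly_cofactor_le)
         (simp_all add: FG eq power_mult_distrib mult.assoc del: mult_pCons_left)
    moreover have "real n ^ r * (\<Sum>i\<le>n. norm (coeff F i)) \<le> real n ^ r * S"
      using sum by (intro mult_left_mono) auto
    ultimately show ?thesis by (simp add: norm_mult norm_power)
  qed
  have "cyc_norm m (pderiv (cyclotomic m)) ^ r * cyc_norm m G =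
      (\<Prod>z\<in>prim_roots m. norm (poly (pderiv (cyclotomic m)) z) ^ r * norm (poly G z))"
    by (simp add: cyc_norm_def prod.distrib prod_power_distrib)
  also have "\<dots> \<le> (\<Prod>z\<in>prim_roots m. real n ^ r * S)"
    using le by (intro prod_mono) auto
  also have "\<dots> = (real n ^ r * S) ^ totient m" using m by (simp add: card_prim_roots)
  finally have upper: "cyc_norm m (pderiv (cyclotomic m)) ^ r * cyc_norm m G \<le> (real n ^ r * S) ^ totient m" .
  have "cyc_norm m (pderiv (cyclotomic m)) \<ge> 1"
    using m by (intro cyc_norm_ge_1) (auto simp: int_coeffs_cyclotomic pderiv_cyclotomic_nonzero)
  hence "1 * cyc_norm m G \<le> cyc_norm m (pderiv (cyclotomic m)) ^ r * cyc_norm m G"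
    by (intro mult_right_mono one_le_power) auto
  with upper have upper: "cyc_norm m G \<le> (real n ^ r * S) ^ totient m" by linarith

  \<comment> \<open>Prime powers determine their prime and exponent, so \<open>T\<close> selects a
    separate cyclotomic factor for each pair in \<open>Q\<close>; \<open>W\<close> is its
    contribution to the norm of \<open>G\<close>.\<close>
  define T where "T = (\<lambda>(p, a). m * p ^ a) ` Q"
  define W where "W = (\<lambda>(p, a). real p ^ (totient m * count M (m * p ^ a)))"
  have inj: "inj_on (\<lambda>(p, a). m * p ^ a) Q"
  proof (rule inj_onI)
    fix x y assume xy: "x \<in> Q" "y \<in> Q" "(case x of (p, a) \<Rightarrow> m * p ^ a) = (case y of (p, a) \<Rightarrow> m * p ^ a)"
    obtain p a p' a' where eqs: "x = (p, a)" "y = (p', a')" by (metis surj_pair)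
    hence "p ^ a = p' ^ a'" using xy m by simp
    thus "x = y"
      using Q(2)[of p a] Q(2)[of p' a'] xy(1,2) prime_power_inj''[of p p' a a'] by (simp add: eqs)
  qed
  have Tm: "t \<noteq> m" if "t \<in> T" for t
  proof -
    obtain p a where pa: "(p, a) \<in> Q" "t = m * p ^ a" using \<open>t \<in> T\<close> by (auto simp: T_def)
    have "prime p" "a > 0" using Q(2)[OF pa(1)] by auto
    hence "p ^ a > 1" using prime_gt_1_nat one_less_power by blast
    hence "m * 1 < m * p ^ a" using m by (intro mult_strict_left_mono) auto
    thus ?thesis unfolding pa(2) by linarith
  qed
  have fT: "finite T" using Q by (simp add: T_def)
  have "cyc_norm m (\<Prod>d\<in>#R. cyclotomic d) = (\<Prod>d\<in>#R. cyc_norm m (cyclotomic d))"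
    by (induction R) (auto simp: cyc_norm_mult)
  also have "\<dots> = (\<Prod>d\<in>set_mset R. cyc_norm m (cyclotomic d) ^ count R d)"
    by (rule image_prod_mset_multiplicity)
  also have "\<dots> = (\<Prod>d\<in>set_mset R \<union> T. cyc_norm m (cyclotomic d) ^ count R d)"
    using fT by (intro prod.mono_neutral_left) (auto simp: not_in_iff)
  \<comment> \<open>The remaining factors do not vanish at primitive \<open>m\<close>-th roots, so
    their norms are at least 1.\<close>
  also have "\<dots> \<ge> (\<Prod>d\<in>T. cyc_norm m (cyclotomic d) ^ count R d)"
  proof (rule prod_mono2)
    fix d assume "d \<in> set_mset R \<union> T - T"
    hence "d \<in># R" by auto
    moreover from this have "d \<noteq> m" by (auto simp: R_def)
    ultimately show "1 \<le> cyc_norm m (cyclotomic d) ^ count R d"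
      using posR m prim_roots_unique
      by (intro one_le_power cyc_norm_ge_1) (auto simp: int_coeffs_cyclotomic poly_cyclotomic_eq_0_iff)
  qed (use fT in auto)
  finally have "cyc_norm m (\<Prod>d\<in>#R. cyclotomic d) \<ge> (\<Prod>d\<in>T. cyc_norm m (cyclotomic d) ^ count R d)" .
  moreover have "(\<Prod>d\<in>T. cyc_norm m (cyclotomic d) ^ count R d) = (\<Prod>x\<in>Q. W x)"
    unfolding T_def prod.reindex[OF inj] o_def
  proof (intro prod.cong refl)
    fix x assume x: "x \<in> Q"
    obtain p a where pa: "x = (p, a)" by fastforce
    have "m * p ^ a \<noteq> m" using Tm x pa by (force simp: T_def)
    thus "cyc_norm m (cyclotomic (case x of (p, a) \<Rightarrow> m * p ^ a)) ^ count R (case x of (p, a) \<Rightarrow> m * p ^ a) = W x"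
      using cyc_norm_cyclotomic_prime_power[of p m a] Q(2)[of p a] x m
      by (simp add: pa W_def R_def power_mult)
  qed
  moreover have "cyc_norm m K \<ge> 1" using F m by (intro cyc_norm_ge_1) auto
  ultimately have "(\<Prod>x\<in>Q. W x) * 1 \<le> cyc_norm m (\<Prod>d\<in>#R. cyclotomic d) * cyc_norm m K"
    by (intro mult_mono) auto
  also have "\<dots> = cyc_norm m G" by (simp add: G_def cyc_norm_mult)
  finally have low: "(\<Prod>x\<in>Q. W x) \<le> (real n ^ r * S) ^ totient m" using upper by simp
  have Wpos: "W x > 0" if "x \<in> Q" for x
    using Q(2)[of "fst x" "snd x"] that by (auto simp: W_def case_prod_unfold prime_gt_0_nat)
  have "real (totient m) * (\<Sum>(p, a)\<in>Q. real (count M (m * p ^ a)) * ln (real p)) = (\<Sum>x\<in>Q. ln (W x))"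
    unfolding sum_distrib_left
    using Q(2) by (intro sum.cong refl) (auto simp: W_def ln_realpow prime_gt_0_nat mult_ac)
  also have "\<dots> = ln (\<Prod>x\<in>Q. W x)"
    using Q(1) Wpos by (intro ln_prod[symmetric]) (auto simp: less_imp_neq[symmetric])
  also have "\<dots> \<le> ln ((real n ^ r * S) ^ totient m)"
    using low by (intro ln_mono prod_pos Wpos) auto
  also have "\<dots> = real (totient m) * (real r * ln (real n) + ln S)"
    using n sum(2) by (simp add: ln_realpow ln_mult)
  finally show ?thesis using tot by (simp add: r_def)
qed

subsection \<open>Polynomials in the shift operator\<close>

text \<open>The variable acts as the backward shift, so multiplication of polynomials becomes
  composition and \<open>monom 1 k - 1\<close> expresses periodicity.\<close>

definition shift_op :: "complex poly \<Rightarrow> (int \<Rightarrow> complex) \<Rightarrow> int \<Rightarrow> complex" where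
  "shift_op p f x = (\<Sum>i\<le>degree p. coeff p i * f (x - int i))"

lemma shift_op_eq:
  assumes "degree p \<le> n"
  shows "shift_op p f x = (\<Sum>i\<le>n. coeff p i * f (x - int i))"
  unfolding shift_op_def using assms by (intro sum.mono_neutral_left) (auto simp: coeff_eq_0)

lemma shift_op_0 [simp]: "shift_op 0 f x = 0"
  by (simp add: shift_op_def)

lemma shift_op_1 [simp]: "shift_op 1 f = f"
  by (rule ext) (simp add: shift_op_def)

lemma shift_op_zero_fun [simp]: "shift_op p (\<lambda>_. 0) = (\<lambda>_. 0)"
  by (rule ext) (simp add: shift_op_def)

lemma shift_op_add: "shift_op (p + q) f x = shift_op p f x + shift_op q f x"
  using degree_add_le_max[of p q]
  by (simp add: shift_op_eq[of _ "max (degree p) (degree q)"] sum.distrib ring_distribs)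

lemma shift_op_smult: "shift_op (smult c p) f x = c * shift_op p f x"
  using degree_smult_le[of c p]
  by (simp add: shift_op_eq[of _ "degree p"] sum_distrib_left mult.assoc)

lemma shift_op_pCons: "shift_op (pCons a p) f x = a * f x + shift_op p f (x - 1)"
proof -
  have "shift_op (pCons a p) f x = (\<Sum>i\<le>Suc (degree p). coeff (pCons a p) i * f (x - int i))"
    by (rule shift_op_eq) (rule degree_pCons_le)
  also have "\<dots> = a * f x + shift_op p f (x - 1)"
    by (subst sum.atMost_Suc_shift) (simp add: shift_op_def algebra_simps)
  finally show ?thesis .
qed

lemma shift_op_mult: "shift_op (p * q) f x = shift_op p (shift_op q f) x"
proof (induction p arbitrary: x)
  case (pCons a p)
  thus ?case by (simp add: shift_op_add shift_op_smult shift_op_pCons)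
qed simp

lemma shift_op_monom: "shift_op (monom 1 k) f x = f (x - int k)"
  by (induction k arbitrary: x) (simp_all add: monom_Suc shift_op_pCons algebra_simps)

lemma shift_op_monom_diff_1: "shift_op (monom 1 k - 1) f x = f (x - int k) - f x"
proof -
  have "monom 1 k - 1 = monom 1 k + smult (-1) (1 :: complex poly)"
    by (simp only: smult_minus_left smult_1_left diff_conv_add_uminus)
  thus ?thesis by (simp only: shift_op_add shift_op_smult shift_op_monom shift_op_1) simp
qed

lemma shift_op_eigenfunction:
  assumes "\<And>x. f (x - 1) = z * f x"
  shows "shift_op q f x = poly q z * f x"
  by (induction q arbitrary: x) (simp_all add: shift_op_pCons assms algebra_simps)

text \<open>Applying all linear factors but one to \<open>f\<close> leaves a geometric sequence, on
  which \<open>q\<close> acts as multiplication by its nonzero value at \<open>z\<close>. So the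
  linear factors can be removed one by one.\<close>

lemma root_poly_annihilator_cancel:
  assumes "finite S" "\<And>z. z \<in> S \<Longrightarrow> poly q z \<noteq> 0"
    and "\<And>x. shift_op (root_poly S) f x = 0" "\<And>x. shift_op q f x = 0"
  shows "f x = 0"
  using assms
proof (induction S arbitrary: x rule: finite_induct)
  case empty
  thus ?case by (simp add: root_poly_def)
next
  case (insert z S)
  define g where "g = shift_op (root_poly S) f"
  have "root_poly (insert z S) = [:-z, 1:] * root_poly S"
    unfolding root_poly_def by (rule prod.insert) fact+
  hence "shift_op [:-z, 1:] g x = 0" for x
    using insert.prems(2)[of x] by (simp only: g_def shift_op_mult)
  hence ev: "g (x - 1) = z * g x" for x by (simp add: shift_op_pCons)
  have "shift_op q f = (\<lambda>_. 0)" using insert.prems(3) by auto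
  hence "shift_op q g x = 0" for x
    unfolding g_def by (metis shift_op_mult mult.commute shift_op_zero_fun)
  hence "g x = 0" for x
    using shift_op_eigenfunction[of g z q x] ev insert.prems(1)[of z] by simp
  thus ?case using insert.IH insert.prems by (simp add: g_def)
qed

text \<open>The roots of \<open>monom 1 k - 1\<close> at which \<open>q\<close> is nonzero can be
  cancelled; the product over the others already kills \<open>f\<close>, and it divides
  \<open>monom 1 l - 1\<close>.\<close>

lemma periodic_of_annihilator:
  fixes f :: "int \<Rightarrow> complex"
  assumes per: "\<And>x. f (x - int k) = f x" "k > 0"
    and q: "\<And>x. shift_op q f x = 0"
    and l: "l > 0" "\<And>z. z ^ k = 1 \<Longrightarrow> poly q z = 0 \<Longrightarrow> z ^ l = 1"
  shows "f (x + int l) = f x"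
proof -
  define S where "S = {z. z ^ k = 1 \<and> poly q z = 0}"
  define S' where "S' = {z. z ^ k = 1 \<and> poly q z \<noteq> 0}"
  have fin: "finite {z::complex. z ^ j = 1}" if "j > 0" for j
    using that finite_roots_unity[of j] by simp
  have "finite S" "finite S'" using fin[OF per(2)] by (auto simp: S_def S'_def)
  hence eq: "root_poly S' * root_poly S = monom 1 k - 1"
    unfolding root_poly_roots_unity[OF per(2), symmetric] root_poly_def
    by (subst prod.union_disjoint[symmetric]) (auto simp: S_def S'_def intro!: prod.cong)
  have "root_poly {z. z ^ l = 1} = root_poly ({z. z ^ l = 1} - S) * root_poly S"
    unfolding root_poly_def using fin[OF l(1)] l(2) by (intro prod.subset_diff) (auto simp: S_def)
  hence dvd: "monom 1 l - 1 = root_poly ({z. z ^ l = 1} - S) * root_poly S"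
    using root_poly_roots_unity[OF l(1)] by simp
  define g where "g = shift_op (root_poly S) f"
  have "shift_op q f = (\<lambda>_. 0)" using q by auto
  hence gq: "shift_op q g x = 0" for x
    unfolding g_def by (metis shift_op_mult mult.commute shift_op_zero_fun)
  have gS': "shift_op (root_poly S') g x = 0" for x
    unfolding g_def shift_op_mult[symmetric] eq by (simp add: shift_op_monom_diff_1 per)
  have "g y = 0" for y
    by (rule root_poly_annihilator_cancel[OF \<open>finite S'\<close> _ gS' gq]) (simp add: S'_def)
  hence "g = (\<lambda>_. 0)" by auto
  hence "shift_op (monom 1 l - 1) f (x + int l) = 0"
    unfolding dvd shift_op_mult g_def[symmetric] by simp
  thus ?thesis by (simp add: shift_op_monom_diff_1)
qed

subsection \<open>Two-valued solutions of linear recurrences\<close>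

text \<open>A window of \<open>n\<close> consecutive zeros extends upwards because
  \<open>w 0\<close> is nonzero and downwards because \<open>w n\<close> is nonzero.\<close>

lemma recurrence_zero:
  fixes \<delta> :: "int \<Rightarrow> complex"
  assumes rec: "\<And>x. (\<Sum>i\<le>n. w i * \<delta> (x - int i)) = 0" and w: "w 0 \<noteq> 0" "w n \<noteq> 0"
    and window: "\<And>i. i \<in> {1..n} \<Longrightarrow> \<delta> (x0 - int i) = 0"
  shows "\<delta> x = 0"
proof -
  define Z where "Z = (\<lambda>x. \<forall>i\<in>{1..n}. \<delta> (x - int i) = 0)"
  have zero: "\<delta> x = 0" if "Z x" for x
  proof -
    have "{..n} = insert 0 {1..n}" by auto
    hence "w 0 * \<delta> x + (\<Sum>i\<in>{1..n}. w i * \<delta> (x - int i)) = 0" using rec[of x] by simp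
    thus ?thesis using that w by (simp add: Z_def)
  qed
  have up: "Z (x + 1)" if "Z x" for x
    unfolding Z_def
  proof
    fix i assume i: "i \<in> {1..n}"
    show "\<delta> (x + 1 - int i) = 0"
    proof (cases "i = 1")
      case False
      hence "\<delta> (x - int (i - 1)) = 0" using that i unfolding Z_def by (intro that[unfolded Z_def, rule_format]) auto
      thus ?thesis using i by (simp add: of_nat_diff algebra_simps)
    qed (use zero[OF that] in simp)
  qed
  have down: "Z (x - 1)" if "Z x" for x
    unfolding Z_def
  proof
    fix i assume i: "i \<in> {1..n}"
    have less: "\<delta> (x - 1 - int j) = 0" if "j < n" for j
      using \<open>Z x\<close>[unfolded Z_def, rule_format, of "Suc j"] that by (simp add: algebra_simps)
    show "\<delta> (x - 1 - int i) = 0"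
    proof (cases "i = n")
      case True
      have "{..n} = insert n {..<n}" by auto
      hence "w n * \<delta> (x - 1 - int n) + (\<Sum>j<n. w j * \<delta> (x - 1 - int j)) = 0"
        using rec[of "x - 1"] by simp
      thus ?thesis using less w True by simp
    qed (use i less in auto)
  qed
  have "Z x0" using window by (simp add: Z_def)
  hence "Z x"
  proof (induction x rule: int_induct[of _ x0])
    case (step1 i) thus ?case using up by simp
  next
    case (step2 i) thus ?case using down by simp
  qed
  thus ?thesis by (rule zero)
qed

text \<open>Among the finitely many possible windows two agree, so the difference of
  \<open>f\<close> and a shift solves the homogeneous recurrence and vanishes on a window. The
  period may be huge; it only gives access to \<open>periodic_of_annihilator\<close>.\<close>

lemma two_valued_recurrence_periodic:
  fixes f :: "int \<Rightarrow> complex"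
  assumes rec: "\<And>x. (\<Sum>i\<le>n. w i * f (x - int i)) = t" and w: "w 0 \<noteq> 0" "w n \<noteq> 0"
    and f: "\<And>x. f x \<in> {0, 1}"
  shows "\<exists>k>0. \<forall>x. f (x - int k) = f x"
proof -
  define st where "st = (\<lambda>N::nat. \<lambda>i\<in>{1..n}. f (int N - int i))"
  have "range st \<subseteq> PiE {1..n} (\<lambda>_. {0, 1})" using f by (force simp: st_def)
  moreover have "finite (PiE {1..n} (\<lambda>_. {0, 1 :: complex}))" by (intro finite_PiE) auto
  ultimately have "finite (range st)" by (rule finite_subset)
  hence "\<not> inj st" using finite_imageD by blast
  then obtain M N where MN: "M < N" "st M = st N"
    by (metis linorder_injI)
  define k where "k = N - M"
  have "f (x + int k) - f x = 0" for x
  proof (rule recurrence_zero[where \<delta> = "\<lambda>x. f (x + int k) - f x"])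
    show "(\<Sum>i\<le>n. w i * (f (x - int i + int k) - f (x - int i))) = 0" for x
      using rec[of x] rec[of "x + int k"]
      by (simp add: right_diff_distrib sum_subtractf algebra_simps)
    show "f (int M - int i + int k) - f (int M - int i) = 0" if "i \<in> {1..n}" for i
      using fun_cong[OF MN(2), of i] that MN(1) by (simp add: st_def k_def of_nat_diff)
  qed (use w in auto)
  from this[of "x - int k" for x] show ?thesis using MN(1)
    by (intro exI[of _ k]) (auto simp: k_def)
qed

subsection \<open>Prime factors and the totient function\<close>

text \<open>The extreme case is \<open>{2..k + 1}\<close>, where the product telescopes. In general
  the maximum \<open>b\<close> is at least 2 more than the number of remaining elements.\<close>

lemma prod_one_minus_inverse_ge:
  assumes "finite S" "\<And>x. x \<in> S \<Longrightarrow> x \<ge> (2::nat)"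
  shows "(\<Prod>x\<in>S. 1 - 1 / real x) \<ge> 1 / (real (card S) + 1)"
  using assms
proof (induction S rule: finite_linorder_max_induct)
  case (insert b A)
  have "A \<subseteq> {2..<b}" using insert by auto
  hence "card A \<le> b - 2" using card_mono[of "{2..<b}" A] by simp
  hence b: "real b \<ge> real (card A) + 2" using insert.prems[of b] by simp
  hence "1 - 1 / real b \<ge> 1 - 1 / (real (card A) + 2)"
    by (intro diff_left_mono divide_left_mono) auto
  moreover have "(\<Prod>x\<in>A. 1 - 1 / real x) \<ge> 1 / (real (card A) + 1)" using insert by auto
  ultimately have "(1 - 1 / (real (card A) + 2)) * (1 / (real (card A) + 1)) \<le>
      (1 - 1 / real b) * (\<Prod>x\<in>A. 1 - 1 / real x)"
    using b by (intro mult_mono) (auto simp: field_simps)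
  moreover have "(1 - 1 / (real (card A) + 2)) * (1 / (real (card A) + 1)) = 1 / (real (card A) + 2)"
    by (simp add: divide_simps)
  moreover have "b \<notin> A" using insert by auto
  ultimately show ?case using insert by (simp add: add_ac)
qed auto

lemma totient_ge:
  assumes "d > 0"
  shows "real d \<le> real (totient d) * (real (card (prime_factors d)) + 1)"
proof -
  have "1 / (real (card (prime_factors d)) + 1) \<le> (\<Prod>p\<in>prime_factors d. 1 - 1 / real p)"
    by (intro prod_one_minus_inverse_ge) (auto dest: in_prime_factors_imp_prime prime_ge_2_nat)
  hence "real d * (1 / (real (card (prime_factors d)) + 1)) \<le> real d * (\<Prod>p\<in>prime_factors d. 1 - 1 / real p)"
    by (intro mult_left_mono) auto
  also have "\<dots> = real (totient d)" by (simp add: totient_formula2)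
  finally show ?thesis by (simp add: field_simps)
qed

lemma two_power_card_prime_factors_le:
  assumes "d > 0"
  shows "2 ^ card (prime_factors d) \<le> (d::nat)"
proof -
  have "2 ^ card (prime_factors d) = (\<Prod>p\<in>prime_factors d. (2::nat))" by simp
  also have "\<dots> \<le> (\<Prod>p\<in>prime_factors d. p ^ multiplicity p d)"
  proof (intro prod_mono conjI)
    fix p assume p: "p \<in> prime_factors d"
    hence "p \<ge> 2" by (auto dest: in_prime_factors_imp_prime prime_ge_2_nat)
    moreover have "multiplicity p d > 0" using p by (simp add: prime_factors_multiplicity)
    hence "p ^ 1 \<le> p ^ multiplicity p d" using \<open>p \<ge> 2\<close> by (intro power_increasing) auto
    ultimately show "2 \<le> p ^ multiplicity p d" by simp
  qed auto
  also have "\<dots> = d" using assms by (simp add: prime_factorization_nat[symmetric])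
  finally show ?thesis .
qed

lemma card_prime_factors_le_log:
  assumes "d > 0"
  shows "real (card (prime_factors d)) \<le> ln (real d) / ln 2"
proof -
  have "2 ^ card (prime_factors d) \<le> real d"
    using two_power_card_prime_factors_le[OF assms] by (metis of_nat_le_iff of_nat_numeral of_nat_power)
  hence "ln (2 ^ card (prime_factors d)) \<le> ln (real d)" by (intro ln_mono) auto
  thus ?thesis by (simp add: ln_realpow field_simps)
qed

text \<open>With \<open>k\<close> prime factors, \<open>d\<close> is at most \<open>k + 1\<close>
  times its totient, and \<open>(k + 1) ^ 2 \<le> 4 * 2 ^ k \<le> 4 * d\<close>. A bound on the
  totient thus bounds \<open>d\<close> polynomially.\<close>

lemma le_square_totient:
  assumes "d > 0"
  shows "real d \<le> 4 * real (totient d) ^ 2"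
proof -
  define k where "k = card (prime_factors d)"
  have *: "(k + 1) ^ 2 \<le> 4 * 2 ^ k" for k :: nat
  proof (induction k)
    case (Suc k)
    show ?case
    proof (cases "k \<le> 1")
      case True
      hence "k = 0 \<or> k = 1" by auto
      thus ?thesis by (auto simp: power2_eq_square)
    next
      case False
      then obtain l where "k = l + 2" by (metis add.commute le_Suc_ex not_less_eq_eq numeral_2_eq_2 One_nat_def)
      hence "(Suc k + 1) ^ 2 \<le> 2 * (k + 1) ^ 2" by (simp add: power2_eq_square algebra_simps)
      thus ?thesis using Suc by simp
    qed
  qed auto
  have "(k + 1) ^ 2 \<le> 4 * d"
    using *[of k] two_power_card_prime_factors_le[OF assms] unfolding k_def by linarith
  from of_nat_mono[OF this, where 'a = real]
  have k: "(real k + 1) ^ 2 \<le> 4 * real d" by (simp add: add.commute)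
  have "real d ^ 2 \<le> (real (totient d) * (real k + 1)) ^ 2"
    using totient_ge[OF assms] unfolding k_def by (intro power_mono) auto
  also have "\<dots> \<le> real (totient d) ^ 2 * (4 * real d)"
    unfolding power_mult_distrib by (intro mult_left_mono k) auto
  finally have "real d * real d \<le> real d * (4 * real (totient d) ^ 2)"
    by (simp add: power2_eq_square mult_ac)
  thus ?thesis using assms by (simp add: mult_le_cancel_left)
qed

lemma prime_factors_mult_prime_power:
  fixes m p v :: nat
  assumes "m > 0" "prime p" "\<not> p dvd m" "v > 0"
  shows "prime_factors (m * p ^ v) = insert p (prime_factors m)"
  using assms by (subst prime_factors_product) (auto simp: prime_factors_power prime_prime_factors)

lemma multiplicity_mult_prime_power:
  fixes m p v :: nat
  assumes "m > 0" "prime p" "\<not> p dvd m"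
  shows "multiplicity p (m * p ^ v) = v"
  using assms by (subst prime_elem_multiplicity_mult_distrib)
    (auto simp: not_dvd_imp_multiplicity_0 multiplicity_same_power prime_gt_0_nat)

lemma prime_factor_decompose:
  fixes m p :: nat
  assumes "p \<in> prime_factors m"
  obtains m' where "m = m' * p ^ multiplicity p m" "\<not> p dvd m'" "m' > 0" "m' \<le> m"
    "prime p" "multiplicity p m > 0" "m div p ^ multiplicity p m = m'"
proof -
  have p: "prime p" "m \<noteq> 0" "p dvd m" using assms by (auto simp: prime_factors_dvd in_prime_factors_iff)
  obtain m' where m': "m = p ^ multiplicity p m * m'" "\<not> p dvd m'"
    using multiplicity_decompose'[of m p] p by (metis not_prime_unit)
  have pos: "p ^ multiplicity p m > 0" using p prime_gt_0_nat by simp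
  have "m' > 0" using m' by (intro Nat.gr0I) auto
  moreover have "m' \<le> m" using m'(1) pos by (metis dvd_imp_le dvd_triv_right bot_nat_0.not_eq_extremum p(2))
  moreover have "m div p ^ multiplicity p m = m'" using m'(1) pos by (metis nonzero_mult_div_cancel_left less_irrefl)
  moreover have "multiplicity p m > 0" using p by (simp add: prime_multiplicity_gt_zero_iff)
  ultimately show ?thesis using that[of m'] m' p by (simp add: mult.commute)
qed

subsection \<open>Sums of cyclotomic multiplicities\<close>

text \<open>Collects what is needed about the multiplicities \<open>r d\<close>, so that the rest is
  elementary counting. The two bounds come from comparing norms and from the degree of
  \<open>F\<close>.\<close>

locale multiplicity_bound =
  fixes r :: "nat \<Rightarrow> nat" and N c :: real
  assumes N: "N \<ge> 2" and c: "c \<ge> 1" and r_1: "r 1 = 0"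
    and multiplicity_bound:
      "\<And>m Q. m > 0 \<Longrightarrow> finite Q \<Longrightarrow>
        (\<And>p a. (p, a) \<in> Q \<Longrightarrow> prime p \<and> \<not> p dvd m \<and> a > 0) \<Longrightarrow>
        (\<Sum>(p, a)\<in>Q. real (r (m * p ^ a)) * ln (real p)) \<le> (real (r m) + c) * ln N"
    and totient_bound:
      "\<And>D. finite D \<Longrightarrow> (\<And>d. d \<in> D \<Longrightarrow> d > 0 \<and> r d > 0) \<Longrightarrow> real (\<Sum>d\<in>D. totient d) \<le> N"
begin

definition L :: real where "L = ln N / ln 2"

lemma L_ge_1: "L \<ge> 1"
  using N by (simp add: L_def field_simps)

text \<open>Removing one prime power from \<open>m\<close> costs a factor \<open>L + 1\<close>, by
  the bound for a single pair and \<open>ln 2 \<le> ln p\<close>.\<close>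

lemma multiplicity_le:
  assumes "m > 0"
  shows "real (r m) + c \<le> c * (L + 1) ^ card (prime_factors m)"
  using assms
proof (induction "card (prime_factors m)" arbitrary: m)
  case 0
  hence "m = 1" by (simp add: prime_factorization_empty_iff)
  thus ?case using r_1 by simp
next
  case (Suc k)
  then obtain p where p: "p \<in> prime_factors m" by fastforce
  obtain m' where m': "m = m' * p ^ multiplicity p m" "\<not> p dvd m'" "m' > 0"
    "prime p" "multiplicity p m > 0"
    using prime_factor_decompose[OF p] by metis
  define v where "v = multiplicity p m"
  note m' = m'[folded v_def]
  have "prime_factors m = insert p (prime_factors m')"
    using prime_factors_mult_prime_power[OF m'(3,4,2,5)] m'(1) by simp
  moreover have "p \<notin> prime_factors m'" using m' by (auto simp: in_prime_factors_iff)
  ultimately have card: "card (prime_factors m') = k" using Suc.hyps(2) by simp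
  have "ln 2 \<le> ln (real p)" using prime_ge_2_nat[OF m'(4)] by simp
  hence "real (r m) * ln 2 \<le> real (r m) * ln (real p)" by (intro mult_left_mono) auto
  also have "\<dots> \<le> (real (r m') + c) * ln N"
    using multiplicity_bound[of m' "{(p, v)}"] m' by auto
  finally have "real (r m) \<le> (real (r m') + c) * L" by (simp add: L_def field_simps)
  hence "real (r m) + c \<le> (real (r m') + c) * (L + 1)" by (simp add: algebra_simps)
  also have "\<dots> \<le> c * (L + 1) ^ k * (L + 1)"
    using Suc.hyps(1)[of m'] card m' L_ge_1 by (intro mult_right_mono) auto
  finally show ?case using Suc.hyps(2) by (simp add: mult_ac flip: Suc.hyps(2))
qed

definition big :: "nat \<Rightarrow> nat \<Rightarrow> nat set" where
  "big P m = {p \<in> prime_factors m. p > P}"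

text \<open>Grading by the primes above \<open>P\<close> separates two effects: at most
  \<open>P\<close> primes are small, and each large prime costs only \<open>ln N / ln P\<close> in
  the recursion.\<close>

definition level :: "nat \<Rightarrow> nat \<Rightarrow> nat \<Rightarrow> nat set" where
  "level P X k = {m \<in> {1..X}. card (big P m) = k}"

lemma finite_level [simp]: "finite (level P X k)"
  by (simp add: level_def)

lemma finite_big [simp]: "finite (big P m)"
  by (simp add: big_def)

lemma card_level: "card (level P X k) \<le> X"
  using card_mono[of "{1..X}" "level P X k"] by (force simp: level_def)

lemma big_mult_prime_power:
  assumes "m > 0" "prime p" "\<not> p dvd m" "v > 0" "p > P"
  shows "big P (m * p ^ v) = insert p (big P m)" "p \<notin> big P m"
  using assms by (auto simp: big_def prime_factors_mult_prime_power in_prime_factors_iff)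

text \<open>Counting the pairs of \<open>m\<close> and a prime \<open>p > P\<close> dividing \<open>m\<close> in two ways: each \<open>m\<close> on level \<open>k\<close>
  has \<open>k\<close> such primes, which is where the decisive factor \<open>1 / k\<close> comes from.\<close>
lemma level_step:
  assumes "P \<ge> 2" "k > 0"
  shows "real k * ln (real P) * (\<Sum>m\<in>level P X k. real (r m)) \<le>
         ln N * (\<Sum>m\<in>level P X (k - 1). real (r m) + c)"
proof -
  define Q where "Q = (\<lambda>m. {(p, v). prime p \<and> \<not> p dvd m \<and> v > 0 \<and> p > P \<and> m * p ^ v \<in> level P X k})"
  have finQ: "finite (Q m)" if "m \<in> level P X (k - 1)" for m
  proof (rule finite_subset)
    show "Q m \<subseteq> {..X} \<times> {..X}"
    proof
      fix x assume "x \<in> Q m"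
      then obtain p v where pv: "x = (p, v)" "(p, v) \<in> Q m" by (metis surj_pair)
      hence *: "m * p ^ v \<le> X" "v > 0" "prime p" by (auto simp: Q_def level_def)
      have "m > 0" using that by (simp add: level_def)
      have "p ^ v \<le> m * p ^ v" using \<open>m > 0\<close> by simp
      hence le: "p ^ v \<le> X" using * by linarith
      have "p ^ 1 \<le> p ^ v" using * prime_gt_0_nat[of p] by (intro power_increasing) auto
      hence "p \<le> X" using le by simp
      have "v < 2 ^ v" by (rule less_exp)
      also have "\<dots> \<le> p ^ v" using * prime_ge_2_nat by (intro power_mono) auto
      finally have "v \<le> X" using le by simp
      thus "x \<in> {..X} \<times> {..X}" using \<open>p \<le> X\<close> pv by simp
    qed
  qed auto
  define g where "g = (\<lambda>(m, p). real (r m) * ln (real p))"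
  define h where "h = (\<lambda>(m, x). real (r (m * fst x ^ snd x)) * ln (real (fst x)))"
  \<comment> \<open>The maps \<open>i\<close> and \<open>j\<close> are inverse to each other: a
    number with a marked large prime corresponds to its part coprime to that prime together with the
    exact prime power.\<close>
  define i where "i = (\<lambda>(m::nat, x::nat \<times> nat). (m * fst x ^ snd x, fst x))"
  define j where "j = (\<lambda>(m::nat, p). (m div p ^ multiplicity p m, (p, multiplicity p m)))"
  have "real k * ln (real P) * (\<Sum>m\<in>level P X k. real (r m)) =
      (\<Sum>m\<in>level P X k. \<Sum>p\<in>big P m. real (r m) * ln (real P))"
    by (simp add: sum_distrib_left level_def mult_ac)
  also have "\<dots> \<le> (\<Sum>m\<in>level P X k. \<Sum>p\<in>big P m. real (r m) * ln (real p))"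
    using assms by (intro sum_mono mult_left_mono ln_mono) (auto simp: big_def)
  also have "\<dots> = (\<Sum>y\<in>Sigma (level P X k) (big P). g y)"
    unfolding g_def by (rule sum.Sigma) auto
  also have "\<dots> = (\<Sum>y\<in>Sigma (level P X (k - 1)) Q. h y)"
  proof (rule sum.reindex_bij_witness[where j = j and i = i])
    fix y assume y: "y \<in> Sigma (level P X k) (big P)"
    obtain m p where [simp]: "y = (m, p)" by fastforce
    have m: "m \<in> level P X k" and p: "p \<in> big P m" using y by auto
    obtain m' where m': "m = m' * p ^ multiplicity p m" "\<not> p dvd m'" "m' > 0" "m' \<le> m"
        "prime p" "multiplicity p m > 0" "m div p ^ multiplicity p m = m'"
      using p prime_factor_decompose[of p m] unfolding big_def by blast
    have "big P m = insert p (big P m')" "p \<notin> big P m'"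
      using big_mult_prime_power[of m' p "multiplicity p m" P] m' p by (simp_all add: big_def)
    hence "card (big P m') = k - 1" using m by (auto simp: level_def)
    hence m'_level: "m' \<in> level P X (k - 1)" using m m' by (auto simp: level_def)
    have j: "j y = (m', (p, multiplicity p m))" by (simp add: j_def m'(7))
    show "i (j y) = y" unfolding j i_def using m'(1) by simp
    show "h (j y) = g y" unfolding j h_def g_def using m'(1) by simp
    have "(p, multiplicity p m) \<in> Q m'"
      using m' p m unfolding Q_def big_def by auto
    thus "j y \<in> Sigma (level P X (k - 1)) Q"
      unfolding j using m'_level by simp
  next
    fix y assume y: "y \<in> Sigma (level P X (k - 1)) Q"
    obtain m p v where [simp]: "y = (m, (p, v))" by (metis surj_pair)
    have m: "m > 0" "prime p" "\<not> p dvd m" "v > 0" "p > P" "m * p ^ v \<in> level P X k"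
      using y by (auto simp: Q_def level_def)
    have mult: "multiplicity p (m * p ^ v) = v" using m by (intro multiplicity_mult_prime_power)
    show "j (i y) = y" using mult m prime_gt_0_nat[of p] by (simp add: i_def j_def)
    show "i y \<in> Sigma (level P X k) (big P)"
      using m big_mult_prime_power(1)[of m p v P] by (simp add: i_def)
  qed
  also have "\<dots> = (\<Sum>m\<in>level P X (k - 1). \<Sum>(p, a)\<in>Q m. real (r (m * p ^ a)) * ln (real p))"
    unfolding h_def using finQ by (subst sum.Sigma) (auto simp: case_prod_unfold)
  also have "\<dots> \<le> (\<Sum>m\<in>level P X (k - 1). (real (r m) + c) * ln N)"
    using finQ by (intro sum_mono multiplicity_bound) (auto simp: level_def Q_def)
  also have "\<dots> = ln N * (\<Sum>m\<in>level P X (k - 1). real (r m) + c)"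
    by (simp add: sum_distrib_left mult.commute)
  finally show ?thesis .
qed

text \<open>Iterating \<open>level_step\<close> brings a factor \<open>K / k\<close> at level
  \<open>k\<close>, so the bounds build up partial sums of the exponential series instead of powers
  of \<open>K\<close>.\<close>

lemma level_bound:
  fixes P X k :: nat
  assumes "P \<ge> 2"
  defines "K \<equiv> ln N / ln (real P)"
  defines "D \<equiv> (\<Sum>m\<in>level P X 0. real (r m)) + c * real X"
  shows "(\<Sum>m\<in>level P X k. real (r m)) + c * real X \<le> D * (\<Sum>j\<le>k. K ^ j / fact j)"
proof (induction k)
  case 0
  show ?case by (simp add: D_def)
next
  case (Suc k)
  let ?E = "\<lambda>k. \<Sum>j\<le>k. K ^ j / fact j"
  have lnP: "ln (real P) > 0" using assms by simp
  have K: "K \<ge> 0" using N lnP by (simp add: K_def)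
  have D: "D \<ge> c * real X" "D \<ge> 0"
    using c by (auto simp: D_def intro!: sum_nonneg add_nonneg_nonneg)
  have "(\<Sum>m\<in>level P X k. real (r m) + c) = (\<Sum>m\<in>level P X k. real (r m)) + c * real (card (level P X k))"
    by (simp add: sum.distrib)
  also have "\<dots> \<le> (\<Sum>m\<in>level P X k. real (r m)) + c * real X"
    using card_level[of P X k] c by (intro add_left_mono mult_left_mono) auto
  also note Suc.IH
  finally have "ln N * (\<Sum>m\<in>level P X k. real (r m) + c) \<le> ln N * (D * ?E k)"
    using N by (intro mult_left_mono) auto
  with level_step[of P "Suc k" X] assms(1)
  have "real (Suc k) * ln (real P) * (\<Sum>m\<in>level P X (Suc k). real (r m)) \<le> ln N * (D * ?E k)"
    by (simp del: of_nat_Suc)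
  hence step: "(\<Sum>m\<in>level P X (Suc k). real (r m)) \<le> D * (K / real (Suc k) * ?E k)"
    using lnP by (simp add: K_def field_simps del: of_nat_Suc)
  have "K / real (Suc k) * ?E k \<le> (\<Sum>j\<le>k. K ^ Suc j / fact (Suc j))"
    unfolding sum_distrib_left
  proof (rule sum_mono)
    fix j assume "j \<in> {..k}"
    have "K / real (Suc k) * (K ^ j / fact j) = K ^ Suc j / (real (Suc k) * fact j)" by simp
    also have "\<dots> \<le> K ^ Suc j / (real (Suc j) * fact j)"
      using K \<open>j \<in> {..k}\<close> by (intro divide_left_mono mult_right_mono) (auto simp del: of_nat_Suc)
    also have "real (Suc j) * fact j = fact (Suc j)" by simp
    finally show "K / real (Suc k) * (K ^ j / fact j) \<le> K ^ Suc j / fact (Suc j)" .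
  qed
  \<comment> \<open>The shifted sum lacks the term for exponent 0; this leaves a spare
    \<open>D\<close>, which absorbs \<open>c * real X\<close>.\<close>
  also have "(\<Sum>j\<le>k. K ^ Suc j / fact (Suc j)) = ?E (Suc k) - 1"
    by (subst sum.atMost_Suc_shift) simp
  finally have "D * (K / real (Suc k) * ?E k) \<le> D * (?E (Suc k) - 1)"
    using D by (intro mult_left_mono)
  with step D(1) show ?case by (simp add: right_diff_distrib del: sum.atMost_Suc of_nat_Suc)
qed

text \<open>On level 0 at most \<open>P\<close> primes divide \<open>m\<close>, so
  \<open>multiplicity_le\<close> bounds each term. Higher levels lose at most the factor
  \<open>exp (ln N / ln P)\<close>, a small power of \<open>N\<close>, and at most
  \<open>L + 1\<close> levels occur.\<close>

lemma sum_multiplicity_le: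
  assumes "P \<ge> 2" "real X \<le> N"
  shows "(\<Sum>m\<in>{1..X}. real (r m) + c) \<le>
         2 * c * real X * (L + 1) ^ (P + 1) * N powr (1 / ln (real P))"
proof -
  define D where "D = (\<Sum>m\<in>level P X 0. real (r m)) + c * real X"
  define kmax where "kmax = nat \<lfloor>L\<rfloor>"
  have lnP: "ln (real P) > 0" using assms by simp
  have L: "L \<ge> 1" by (rule L_ge_1)
  have pow: "1 \<le> (L + 1) ^ P" using L by (intro one_le_power) auto
  have "(\<Sum>m\<in>level P X 0. real (r m)) \<le> (\<Sum>m\<in>level P X 0. c * (L + 1) ^ P)"
  proof (rule sum_mono)
    fix m assume m: "m \<in> level P X 0"
    have "prime_factors m \<subseteq> {1..P}"
    proof
      fix p assume p: "p \<in> prime_factors m"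
      have "p \<notin> big P m" using m by (auto simp: level_def)
      thus "p \<in> {1..P}" using p prime_gt_0_nat[of p] by (auto simp: big_def in_prime_factors_imp_prime)
    qed
    hence "card (prime_factors m) \<le> P" using card_mono[of "{1..P}"] by fastforce
    hence "c * (L + 1) ^ card (prime_factors m) \<le> c * (L + 1) ^ P"
      using c L by (intro mult_left_mono power_increasing) auto
    moreover have "real (r m) + c \<le> c * (L + 1) ^ card (prime_factors m)"
      using m by (intro multiplicity_le) (auto simp: level_def)
    ultimately show "real (r m) \<le> c * (L + 1) ^ P" using c by linarith
  qed
  also have "\<dots> = real (card (level P X 0)) * (c * (L + 1) ^ P)" by simp
  also have "\<dots> \<le> real X * (c * (L + 1) ^ P)"
    using card_level[of P X 0] c pow by (intro mult_right_mono) auto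
  finally have "(\<Sum>m\<in>level P X 0. real (r m)) \<le> c * real X * (L + 1) ^ P" by (simp add: mult_ac)
  moreover have "c * real X * 1 \<le> c * real X * (L + 1) ^ P"
    using c pow by (intro mult_left_mono) auto
  ultimately have D: "D \<le> 2 * c * real X * (L + 1) ^ P" by (simp add: D_def)
  have D0: "D \<ge> 0" using c by (auto simp: D_def intro!: sum_nonneg add_nonneg_nonneg)
  have Y: "(\<Sum>m\<in>level P X k. real (r m)) + c * real X \<le> D * N powr (1 / ln (real P))" for k
  proof -
    define K where "K = ln N / ln (real P)"
    have K: "K \<ge> 0" using N lnP by (simp add: K_def)
    have "(\<Sum>j\<le>k. K ^ j / fact j) \<le> exp K"
      using K exp_converges[of K] unfolding exp_def
      by (simp add: divide_inverse mult.commute scaleR_conv_of_real summable_exp_generic)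
         (intro sum_le_suminf, auto intro: summable_exp)
    also have "exp K = N powr (1 / ln (real P))" using N by (simp add: powr_def K_def)
    finally have "D * (\<Sum>j\<le>k. K ^ j / fact j) \<le> D * N powr (1 / ln (real P))"
      using D0 by (intro mult_left_mono)
    thus ?thesis using level_bound[OF assms(1), of X k] by (simp add: D_def K_def)
  qed
  have kmax: "real kmax \<le> L" using L by (simp add: kmax_def)
  have Un: "{1..X} = (\<Union>k\<in>{..kmax}. level P X k)"
  proof (intro equalityI subsetI)
    fix m assume m: "m \<in> {1..X}"
    have "card (big P m) \<le> card (prime_factors m)"
      by (intro card_mono) (auto simp: big_def)
    hence "real (card (big P m)) \<le> ln (real m) / ln 2"
      using card_prime_factors_le_log[of m] m by simp
    also have "\<dots> \<le> L" unfolding L_def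
      using m assms(2) N by (intro divide_right_mono ln_mono) auto
    finally have "card (big P m) \<le> kmax" by (simp add: kmax_def le_nat_floor)
    thus "m \<in> (\<Union>k\<in>{..kmax}. level P X k)" using m by (auto simp: level_def)
  qed (auto simp: level_def)
  have "(\<Sum>m\<in>{1..X}. real (r m)) = (\<Sum>k\<le>kmax. \<Sum>m\<in>level P X k. real (r m))"
    unfolding Un by (rule sum.UNION_disjoint) (auto simp: level_def)
  moreover have "(\<Sum>m\<in>{1..X}. c) \<le> (\<Sum>k\<le>kmax. c * real X)"
  proof -
    have "1 * (c * real X) \<le> (real kmax + 1) * (c * real X)"
      using c by (intro mult_right_mono) auto
    thus ?thesis by (simp add: mult_ac add_ac)
  qed
  ultimately have "(\<Sum>m\<in>{1..X}. real (r m) + c) \<le> (\<Sum>k\<le>kmax. (\<Sum>m\<in>level P X k. real (r m)) + c * real X)"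
    unfolding sum.distrib by linarith
  also have "\<dots> \<le> (\<Sum>k\<le>kmax. D * N powr (1 / ln (real P)))"
    by (intro sum_mono Y)
  also have "\<dots> = (real kmax + 1) * (D * N powr (1 / ln (real P)))" by simp
  also have "\<dots> \<le> (L + 1) * ((2 * c * real X * (L + 1) ^ P) * N powr (1 / ln (real P)))"
    using kmax D D0 L by (intro mult_mono mult_right_mono) auto
  finally show ?thesis by (simp add: mult_ac)
qed


text \<open>A prime power \<open>q\<close> exactly dividing the common multiple comes from some \<open>d = m q\<close> with
  \<open>r d > 0\<close>. With \<open>X\<close> about \<open>N\<^sup>1\<^sup>/\<^sup>3\<close>, there are few such \<open>q\<close> with \<open>q \<le> X\<close> trivially, few with
  \<open>q, m > X\<close> since the totients of the \<open>d\<close> sum up to at most \<open>N\<close>, and few with \<open>m \<le> X\<close> by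
  the bound on the sum of the multiplicities \<open>r m\<close>.\<close>
lemma common_multiple_bound:
  assumes D: "finite D" "\<And>d. d \<in> D \<Longrightarrow> d > 0 \<and> r d > 0" and P: "P \<ge> 2"
  shows "\<exists>l>0. (\<forall>d\<in>D. d dvd l) \<and>
           ln (real l) \<le> (2 + 2 * c) * (2 * L + 3) ^ (P + 3) * N powr (1 / 3 + 1 / ln (real P))"
proof -
  \<comment> \<open>The exponent 1/3 balances \<open>X\<close>, which up to smaller factors bounds
    \<open>S1\<close> and \<open>S3\<close>, against \<open>N / X ^ 2\<close>, which does so for
    \<open>S2\<close>.\<close>
  define X where "X = nat \<lfloor>N powr (1/3)\<rfloor>"
  \<comment> \<open>Since \<open>d \<le> 4 * N ^ 2\<close> for \<open>d\<close> in \<open>D\<close>,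
    this bounds both \<open>ln d\<close> and the number of prime factors of \<open>d\<close> plus
    1.\<close>
  define B where "B = 2 * L + 3"
  define S where "S = (\<Union>d\<in>D. prime_factors d)"
  define e where "e = (\<lambda>p. Max ((\<lambda>d. multiplicity p d) ` D))"
  define l where "l = (\<Prod>p\<in>S. p ^ e p)"
  have L: "L \<ge> 1" by (rule L_ge_1)
  have finS: "finite S" using D by (simp add: S_def)
  have prS: "prime p" if "p \<in> S" for p using that by (auto simp: S_def)
  have "l > 0" unfolding l_def using prS prime_gt_0_nat by (intro prod_pos) auto
  have dvd: "d dvd l" if "d \<in> D" for d
  proof -
    have "d = (\<Prod>p\<in>prime_factors d. p ^ multiplicity p d)"
      using D(2)[OF that] by (intro prime_factorization_nat) auto
    also have "\<dots> dvd (\<Prod>p\<in>prime_factors d. p ^ e p)"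
      unfolding e_def using D(1) that by (intro prod_dvd_prod le_imp_power_dvd Max_ge) auto
    also have "\<dots> dvd l"
      unfolding l_def using finS that by (intro prod_dvd_prod_subset) (auto simp: S_def)
    finally show ?thesis .
  qed
  have "\<exists>d\<in>D. multiplicity p d = e p" if "p \<in> S" for p
  proof -
    have "D \<noteq> {}" using that by (auto simp: S_def)
    hence "e p \<in> (\<lambda>d. multiplicity p d) ` D" unfolding e_def using D(1) by (intro Max_in) auto
    thus ?thesis by auto
  qed
  \<comment> \<open>A member of \<open>D\<close> with the highest power of \<open>p\<close>;
    \<open>\<mu> p\<close> below is its part coprime to \<open>p\<close>.\<close>
  then obtain \<delta> where \<delta>: "\<delta> p \<in> D" "multiplicity p (\<delta> p) = e p" if "p \<in> S" for p
    by metis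
  have e_pos: "e p > 0" if p: "p \<in> S" for p
  proof -
    obtain d where d: "d \<in> D" "p \<in> prime_factors d" using p by (auto simp: S_def)
    have "0 < multiplicity p d" using d(2) by (simp add: prime_factors_multiplicity)
    also have "\<dots> \<le> e p" unfolding e_def using D(1) d(1) by (intro Max_ge) auto
    finally show ?thesis .
  qed
  have pf\<delta>: "p \<in> prime_factors (\<delta> p)" if "p \<in> S" for p
    using \<delta>[OF that] e_pos[OF that] prS[OF that] by (simp add: prime_factors_multiplicity)
  define \<mu> where "\<mu> = (\<lambda>p. \<delta> p div p ^ e p)"
  have \<mu>: "\<delta> p = \<mu> p * p ^ e p \<and> \<not> p dvd \<mu> p \<and> \<mu> p > 0" if "p \<in> S" for p
    using prime_factor_decompose[OF pf\<delta>[OF that]] \<delta>(2)[OF that] unfolding \<mu>_def by metis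

  have ln_d: "ln (real d) \<le> 2 * ln 2 + 2 * ln N" if "d \<in> D" for d
  proof -
    have d: "d > 0" "r d > 0" using D(2)[OF that] by auto
    have "real (totient d) \<le> N" using totient_bound[of "{d}"] d by simp
    hence "4 * real (totient d) ^ 2 \<le> 4 * N ^ 2" by (intro mult_left_mono power_mono) auto
    hence "real d \<le> 4 * N ^ 2" using le_square_totient[OF d(1)] by linarith
    hence "ln (real d) \<le> ln (4 * N ^ 2)" using d(1) by (intro ln_mono) auto
    also have "\<dots> = ln 4 + 2 * ln N" using N by (simp add: ln_mult ln_realpow)
    also have "ln 4 = 2 * ln (2::real)" using ln_realpow[of 2 2] by simp
    finally show ?thesis .
  qed
  have ln2: "ln 2 \<le> (1::real)" using ln_le_minus_one[of "2::real"] by simp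
  have lnN: "ln N \<le> L"
    using N ln2 mult_left_mono[of "ln 2" 1 "ln N"] by (simp add: L_def field_simps)
  have ln_B: "ln (real d) \<le> B" if "d \<in> D" for d
    using ln_d[OF that] lnN ln2 by (simp add: B_def)
  have card_pf: "real (card (prime_factors d)) + 1 \<le> B" if "d \<in> D" for d
  proof -
    have "ln (real d) / ln 2 \<le> 2 + 2 * L"
      using ln_d[OF that] by (simp add: L_def field_simps)
    thus ?thesis using card_prime_factors_le_log[of d] D(2)[OF that] by (simp add: B_def)
  qed

  define Z where "Z = N powr (1/3)"
  have Z: "Z \<ge> 1" using N by (simp add: Z_def ge_one_powr_ge_zero)
  have Z3: "Z ^ 3 = N" using N by (simp add: Z_def powr_power)
  have X: "real X \<le> Z" "Z < real X + 1" using Z unfolding X_def Z_def by linarith+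
  have "Z ^ 1 \<le> Z ^ 3" using Z by (intro power_increasing) auto
  hence XN: "real X \<le> N" using X Z3 by simp

  \<comment> \<open>Here \<open>p\<close> itself is compared with \<open>X\<close>. Outside
    \<open>S1\<close> and \<open>S3\<close>, both \<open>p ^ e p\<close> and \<open>\<mu> p\<close>
    exceed \<open>X\<close>, so \<open>\<delta> p\<close> is at least
    \<open>(X + 1) ^ 2\<close>.\<close>
  define S1 where "S1 = {p \<in> S. p \<le> X}"
  define S2 where "S2 = {p \<in> S. p > X \<and> \<mu> p > X}"
  define S3 where "S3 = {p \<in> S. \<mu> p \<le> X}"
  define T where "T = (\<Sum>m\<in>{1..X}. real (r m) + c)"

  have "S1 \<subseteq> {1..X}" using prS prime_gt_0_nat by (auto simp: S1_def Suc_le_eq)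
  hence "card S1 \<le> X" using card_mono[of "{1..X}" S1] by simp
  hence c1: "real (card S1) \<le> Z" using X by linarith

  \<comment> \<open>Each \<open>d\<close> in \<open>D'\<close> has totient at least
    \<open>Z ^ 2 / B\<close>, while the totients sum to at most \<open>N = Z ^ 3\<close>; so
    \<open>D'\<close> has at most \<open>B * Z\<close> elements, each with at most \<open>B\<close>
    primes.\<close>
  have c2: "real (card S2) \<le> B ^ 2 * Z"
  proof -
    define D' where "D' = {d \<in> D. d \<ge> (X + 1) ^ 2}"
    have "S2 \<subseteq> (\<Union>d\<in>D'. prime_factors d)"
    proof
      fix p assume "p \<in> S2"
      hence p: "p \<in> S" "p > X" "\<mu> p > X" by (auto simp: S2_def)
      have "p ^ 1 \<le> p ^ e p"
        using e_pos[OF p(1)] prS[OF p(1)] prime_gt_0_nat[of p] by (intro power_increasing) auto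
      hence "(X + 1) * (X + 1) \<le> \<mu> p * p ^ e p" using p by (intro mult_mono) auto
      hence "(X + 1) ^ 2 \<le> \<delta> p" using \<mu>[OF p(1)] by (simp add: power2_eq_square)
      hence "\<delta> p \<in> D'" using \<delta>(1)[OF p(1)] by (simp add: D'_def)
      thus "p \<in> (\<Union>d\<in>D'. prime_factors d)" using pf\<delta>[OF p(1)] by blast
    qed
    hence "card S2 \<le> card (\<Union>d\<in>D'. prime_factors d)"
      using D(1) by (intro card_mono) (auto simp: D'_def)
    also have "\<dots> \<le> (\<Sum>d\<in>D'. card (prime_factors d))"
      using D(1) by (intro card_UN_le) (auto simp: D'_def)
    finally have "real (card S2) \<le> (\<Sum>d\<in>D'. real (card (prime_factors d)))"
      by (metis of_nat_le_iff of_nat_sum)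
    also have "\<dots> \<le> (\<Sum>d\<in>D'. B)" using card_pf by (intro sum_mono) (force simp: D'_def)
    finally have "real (card S2) \<le> real (card D') * B" by simp
    moreover have "real (card D') * Z ^ 2 \<le> B * N"
    proof -
      have "real (card D') * Z ^ 2 = (\<Sum>d\<in>D'. Z ^ 2)" by simp
      also have "\<dots> \<le> (\<Sum>d\<in>D'. B * real (totient d))"
      proof (rule sum_mono)
        fix d assume d: "d \<in> D'"
        hence dD: "d \<in> D" "d > 0" using D(2) by (auto simp: D'_def)
        have "Z ^ 2 \<le> (real X + 1) ^ 2" using X Z by (intro power_mono) auto
        also have "\<dots> \<le> real d" using d of_nat_mono[of "(X + 1) ^ 2" d, where 'a = real]
          by (simp add: D'_def add.commute)
        also have "\<dots> \<le> real (totient d) * (real (card (prime_factors d)) + 1)"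
          by (rule totient_ge[OF dD(2)])
        also have "\<dots> \<le> real (totient d) * B" using card_pf[OF dD(1)] by (intro mult_left_mono) auto
        finally show "Z ^ 2 \<le> B * real (totient d)" by (simp add: mult.commute)
      qed
      also have "\<dots> = B * real (\<Sum>d\<in>D'. totient d)" by (simp add: sum_distrib_left)
      also have "\<dots> \<le> B * N"
        using L D by (intro mult_left_mono totient_bound) (auto simp: D'_def B_def)
      finally show ?thesis .
    qed
    hence "real (card D') * Z ^ 2 \<le> (B * Z) * Z ^ 2"
      by (simp add: Z3[symmetric] power3_eq_cube power2_eq_square mult_ac)
    hence "real (card D') \<le> B * Z" using Z by simp
    hence "real (card D') * B \<le> B * Z * B"
      using L by (intro mult_right_mono) (auto simp: B_def)
    ultimately show ?thesis by (simp add: power2_eq_square mult_ac)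
  qed

  \<comment> \<open>The primes are grouped by \<open>m = \<mu> p\<close>. Each adds at least
    \<open>ln 2\<close> to the left side of \<open>multiplicity_bound\<close> for \<open>m\<close>,
    and the right sides sum to \<open>T * ln N\<close>.\<close>
  have c3: "real (card S3) \<le> L * T"
  proof -
    have "real (card S3) * ln 2 = (\<Sum>p\<in>S3. ln 2)" by simp
    also have "\<dots> \<le> (\<Sum>p\<in>S3. real (r (\<delta> p)) * ln (real p))"
    proof (rule sum_mono)
      fix p assume "p \<in> S3"
      hence p: "p \<in> S" by (simp add: S3_def)
      have "r (\<delta> p) \<ge> 1" using D(2)[OF \<delta>(1)[OF p]] by simp
      hence "1 \<le> real (r (\<delta> p))" by linarith
      moreover have "ln 2 \<le> ln (real p)" using prime_ge_2_nat[OF prS[OF p]] by simp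
      ultimately show "ln 2 \<le> real (r (\<delta> p)) * ln (real p)"
        using mult_mono[of 1 "real (r (\<delta> p))" "ln 2" "ln (real p)"] by simp
    qed
    also have "\<dots> = (\<Sum>m\<in>{1..X}. \<Sum>p\<in>{p \<in> S3. \<mu> p = m}. real (r (\<delta> p)) * ln (real p))"
      by (rule sum.group[symmetric]) (use finS \<mu> in \<open>auto simp: S3_def Suc_le_eq\<close>)
    also have "\<dots> \<le> (\<Sum>m\<in>{1..X}. (real (r m) + c) * ln N)"
    proof (rule sum_mono)
      fix m assume m: "m \<in> {1..X}"
      let ?A = "{p \<in> S3. \<mu> p = m}"
      have "(\<Sum>p\<in>?A. real (r (\<delta> p)) * ln (real p)) =
            (\<Sum>(p, a)\<in>(\<lambda>p. (p, e p)) ` ?A. real (r (m * p ^ a)) * ln (real p))"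
        using \<mu> by (subst sum.reindex) (auto simp: inj_on_def S3_def intro!: sum.cong)
      also have "\<dots> \<le> (real (r m) + c) * ln N"
        using m finS \<mu> prS e_pos by (intro multiplicity_bound) (auto simp: S3_def)
      finally show "(\<Sum>p\<in>?A. real (r (\<delta> p)) * ln (real p)) \<le> (real (r m) + c) * ln N" .
    qed
    also have "\<dots> = T * ln N" by (simp add: T_def sum_distrib_right)
    finally show ?thesis by (simp add: L_def field_simps)
  qed

  have "S = S1 \<union> S2 \<union> S3" by (auto simp: S1_def S2_def S3_def)
  hence "card S \<le> card S1 + card S2 + card S3"
    by (metis (no_types, lifting) card_Un_le add_le_mono1 le_trans)
  hence "real (card S) \<le> real (card S1) + real (card S2) + real (card S3)" by linarith
  also have "\<dots> \<le> Z + B ^ 2 * Z + L * T" using c1 c2 c3 by linarith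
  finally have cardS: "real (card S) \<le> Z + B ^ 2 * Z + L * T" .

  define W where "W = N powr (1 / ln (real P))"
  have W: "W \<ge> 1" using N P by (simp add: W_def ge_one_powr_ge_zero)
  have B: "B \<ge> 1" using L by (simp add: B_def)
  have "T \<le> 2 * c * real X * (L + 1) ^ (P + 1) * W"
    unfolding T_def W_def by (rule sum_multiplicity_le[OF P XN])
  also have "\<dots> \<le> 2 * c * Z * B ^ (P + 1) * W"
    using X c L W Z by (intro mult_mono power_mono) (auto simp: B_def)
  finally have "L * T \<le> B * (2 * c * Z * B ^ (P + 1) * W)"
    using L c by (intro mult_mono) (auto simp: B_def T_def intro!: sum_nonneg)
  hence LT: "L * T \<le> 2 * c * (B ^ (P + 2) * (Z * W))" by (simp add: mult_ac)
  have BP: "1 \<le> B ^ (P + 2)" "B ^ 2 \<le> B ^ (P + 2)"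
    using B by (auto intro!: one_le_power power_increasing simp del: power_Suc power_add)
  have ZW: "Z * 1 \<le> Z * W" using Z W by (intro mult_left_mono) auto
  have "1 * Z \<le> B ^ (P + 2) * (Z * W)" using BP ZW Z by (intro mult_mono) auto
  moreover have "B ^ 2 * Z \<le> B ^ (P + 2) * (Z * W)" using BP ZW Z B by (intro mult_mono) auto
  ultimately have "real (card S) \<le> (2 + 2 * c) * (B ^ (P + 2) * (Z * W))"
    using cardS LT by (simp add: algebra_simps)
  hence fin: "real (card S) * B \<le> (2 + 2 * c) * (B ^ (P + 2) * (Z * W)) * B"
    using B by (intro mult_right_mono) auto

  \<comment> \<open>Each prime power in \<open>l\<close> divides a member of \<open>D\<close>, so
    its logarithm is at most \<open>B\<close>; this is the last of the \<open>P + 3\<close> factors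
    \<open>B\<close>.\<close>
  have "ln (real l) = (\<Sum>p\<in>S. ln (real (p ^ e p)))"
    unfolding l_def of_nat_prod using finS prS prime_gt_0_nat by (intro ln_prod) auto
  also have "\<dots> \<le> (\<Sum>p\<in>S. B)"
  proof (rule sum_mono)
    fix p assume p: "p \<in> S"
    have "p ^ e p \<le> \<delta> p" using \<mu>[OF p] by simp
    hence "ln (real (p ^ e p)) \<le> ln (real (\<delta> p))"
      using prime_gt_0_nat[OF prS[OF p]] by (intro ln_mono) (auto simp del: of_nat_power)
    thus "ln (real (p ^ e p)) \<le> B" using ln_B[OF \<delta>(1)[OF p]] by linarith
  qed
  also have "\<dots> = real (card S) * B" by simp
  also note fin
  also have "(2 + 2 * c) * (B ^ (P + 2) * (Z * W)) * B = (2 + 2 * c) * B ^ (P + 3) * (Z * W)"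
    by (simp add: power_add power2_eq_square power3_eq_cube mult_ac)
  also have "Z * W = N powr (1 / 3 + 1 / ln (real P))" by (simp add: Z_def W_def powr_add)
  finally show ?thesis using \<open>l > 0\<close> dvd by (auto simp: B_def)
qed

end

subsection \<open>Periods of tilings\<close>

text \<open>The locale is instantiated with the multiplicities of the cyclotomic factors of
  \<open>F\<close>. Its value at 1 is a positive coefficient sum, so \<open>cyclotomic 1\<close>
  does not occur.\<close>

lemma cyclotomic_common_multiple:
  fixes w :: "nat \<Rightarrow> nat" and c :: real
  assumes n: "n > 0" and c: "c \<ge> 1" and w0: "w 0 > 0"
    and sum: "real (\<Sum>i\<le>n. w i) \<le> real (n + 1) powr c" and P: "P \<ge> 2"
  defines "N \<equiv> real (n + 1)"
  defines "F \<equiv> (\<Sum>i\<le>n. monom (of_nat (w i)) i :: complex poly)"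
  shows "\<exists>l>0. (\<forall>d>0. \<forall>z\<in>prim_roots d. poly F z = 0 \<longrightarrow> d dvd l) \<and>
           ln (real l) \<le> (2 + 2 * c) * (2 * (ln N / ln 2) + 3) ^ (P + 3) * N powr (1 / 3 + 1 / ln (real P))"
proof -
  have coeff: "coeff F i = (if i \<le> n then of_nat (w i) else 0)" for i
    by (simp add: F_def coeff_sum coeff_monom)
  have deg: "degree F \<le> n" by (intro degree_le) (simp add: coeff)
  have "coeff F 0 \<noteq> 0" using w0 by (simp add: coeff)
  hence "F \<noteq> 0" by auto
  have "int_coeffs F" by (simp add: int_coeffs_def coeff)
  then obtain M K where MK: "0 \<notin># M" "int_coeffs K" "F = (\<Prod>d\<in>#M. cyclotomic d) * K"
    "\<forall>d>0. \<forall>z\<in>prim_roots d. poly K z \<noteq> 0"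
    using ex_cyclotomic_factorization[OF _ \<open>F \<noteq> 0\<close>] by blast
  have root: "poly F z = 0" if "d \<in># M" "z \<in> prim_roots d" for d z
  proof -
    have "d > 0" using that(1) MK(1) by (metis gr0I)
    hence "poly (cyclotomic d) z = 0" using that(2) by (simp add: poly_cyclotomic_eq_0_iff)
    moreover obtain M' where "M = add_mset d M'" using \<open>d \<in># M\<close> by (rule mset_add)
    ultimately show ?thesis by (simp add: MK(3))
  qed
  have norms: "(\<Sum>i\<le>n. norm (coeff F i)) = real (\<Sum>i\<le>n. w i)" by (simp add: coeff)
  interpret multiplicity_bound "count M" N c
  proof
    show "N \<ge> 2" using n by (simp add: N_def)
    show "c \<ge> 1" by fact
    show "count M 1 = 0"
    proof (rule ccontr)
      assume "count M 1 \<noteq> 0"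
      hence "poly F 1 = 0" by (intro root[of 1]) (auto simp: prim_roots_def)
      moreover have "poly F 1 = of_nat (\<Sum>i\<le>n. w i)"
        by (simp add: F_def poly_sum poly_monom)
      ultimately have "(\<Sum>i\<le>n. w i) = 0" by (metis of_nat_eq_0_iff)
      thus False using w0 by simp
    qed
  next
    fix m :: nat and Q :: "(nat \<times> nat) set" assume mQ: "m > 0" "finite Q" "\<And>p a. (p, a) \<in> Q \<Longrightarrow> prime p \<and> \<not> p dvd m \<and> a > 0"
    \<comment> \<open>Taking \<open>n + 1\<close> as degree bound makes both logarithms multiples of
      \<open>ln N\<close>; the extra coefficient is 0.\<close>
    have "(\<Sum>(p, a)\<in>Q. real (count M (m * p ^ a)) * ln (real p)) \<le>
          real (count M m) * ln (real (n + 1)) + ln (real (n + 1) powr c)"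
      using deg MK mQ sum norms coeff
      by (intro cyclotomic_multiplicity_bound[of F M K "n + 1"]) auto
    thus "(\<Sum>(p, a)\<in>Q. real (count M (m * p ^ a)) * ln (real p)) \<le> (real (count M m) + c) * ln N"
      by (simp add: N_def ln_powr algebra_simps)
  next
    fix D assume D: "finite D" "\<And>d. d \<in> D \<Longrightarrow> d > 0 \<and> count M d > 0"
    have pos: "d > 0" if "d \<in># M" for d using MK(1) that by (metis gr0I)
    have "mset_set D \<subseteq># M"
      using D by (intro mset_subset_eqI) (auto simp: count_mset_set' Suc_le_eq)
    then obtain R where R: "M = mset_set D + R" by (metis subset_mset.le_iff_add)
    have "(\<Sum>d\<in>D. totient d) \<le> (\<Sum>d\<in>#M. totient d)"
      unfolding R by (simp add: sum_unfold_sum_mset)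
    also have "\<dots> = degree (\<Prod>d\<in>#M. cyclotomic d)"
      using pos
    proof (induction M)
      case (add x M)
      have "(\<Prod>d\<in>#M. cyclotomic d) \<noteq> 0" by (auto simp: prod_mset_zero_iff)
      thus ?case using add by (simp add: degree_mult_eq)
    qed simp
    also have "\<dots> \<le> degree F"
      using \<open>F \<noteq> 0\<close> unfolding MK(3) by (subst degree_mult_eq) auto
    finally have "(\<Sum>d\<in>D. totient d) \<le> n + 1" using deg by linarith
    thus "real (\<Sum>d\<in>D. totient d) \<le> N" unfolding N_def of_nat_le_iff .
  qed
  obtain l where l: "l > 0" "\<forall>d\<in>set_mset M. d dvd l"
    "ln (real l) \<le> (2 + 2 * c) * (2 * L + 3) ^ (P + 3) * N powr (1 / 3 + 1 / ln (real P))"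
    using common_multiple_bound[of "set_mset M" P] P MK(1)
    by (metis count_greater_zero_iff finite_set_mset gr0I)
  have dvd: "d dvd l" if d: "d > 0" "z \<in> prim_roots d" "poly F z = 0" for d z
  proof -
    have "poly (\<Prod>d\<in>#M. cyclotomic d) z = 0" using MK(3,4) d by auto
    hence "\<exists>d'\<in>#M. poly (cyclotomic d') z = 0" by (induction M) auto
    then obtain d' where d': "d' \<in># M" "poly (cyclotomic d') z = 0" by blast
    have "d' > 0" using d'(1) MK(1) by (metis gr0I)
    hence "z \<in> prim_roots d'" using d'(2) by (simp add: poly_cyclotomic_eq_0_iff)
    thus ?thesis using d'(1) l(2) prim_roots_unique[OF d(2)] by auto
  qed
  show ?thesis
  proof (intro exI[of _ l] conjI allI impI ballI)
    show "l > 0" by (rule l(1))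
    show "d dvd l" if "d > 0" "z \<in> prim_roots d" "poly F z = 0" for d z
      using that by (rule dvd)
    show "ln (real l) \<le> (2 + 2 * c) * (2 * (ln N / ln 2) + 3) ^ (P + 3) * N powr (1 / 3 + 1 / ln (real P))"
      using l(3) unfolding L_def .
  qed
qed

lemma tiling_period:
  fixes w :: "nat \<Rightarrow> nat" and c :: real and f :: "int \<Rightarrow> complex"
  assumes n: "n > 0" and c: "c \<ge> 1" and w: "w 0 > 0" "w n > 0"
    and sum: "real (\<Sum>i\<le>n. w i) \<le> real (n + 1) powr c" and P: "P \<ge> 2"
    and f: "\<And>x. f x \<in> {0, 1}" and tiling: "\<And>x. (\<Sum>i\<le>n. of_nat (w i) * f (x - int i)) = t"
  shows "\<exists>l>0. (\<forall>x. f (x + int l) = f x) \<and>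
           ln (real l) \<le> (2 + 2 * c) * (2 * (ln (real (n + 1)) / ln 2) + 3) ^ (P + 3) *
             real (n + 1) powr (1 / 3 + 1 / ln (real P))"
proof -
  define F where "F = (\<Sum>i\<le>n. monom (of_nat (w i)) i :: complex poly)"
  obtain l where l: "l > 0" "\<forall>d>0. \<forall>z\<in>prim_roots d. poly F z = 0 \<longrightarrow> d dvd l"
    "ln (real l) \<le> (2 + 2 * c) * (2 * (ln (real (n + 1)) / ln 2) + 3) ^ (P + 3) *
             real (n + 1) powr (1 / 3 + 1 / ln (real P))"
    using cyclotomic_common_multiple[OF n c w(1) sum P] unfolding F_def[symmetric]
    by (elim exE conjE) (rule that)
  have "\<exists>k>0. \<forall>x. f (x - int k) = f x"
    using w by (intro two_valued_recurrence_periodic[where w = "\<lambda>i. of_nat (w i)" and n = n and t = t] tiling f) auto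
  then obtain k where k: "k > 0" "\<And>x. f (x - int k) = f x" by blast
  have coeff: "coeff F i = (if i \<le> n then of_nat (w i) else 0)" for i
    by (simp add: F_def coeff_sum coeff_monom)
  have "degree F \<le> n" by (intro degree_le) (simp add: coeff)
  hence "shift_op F f = (\<lambda>_. t)"
    using tiling by (intro ext) (simp add: shift_op_eq coeff)
  \<comment> \<open>The factor \<open>[:-1, 1:]\<close> turns the constant right-hand side into 0.
    It adds only the root 1, which satisfies \<open>z ^ l = 1\<close> anyway.\<close>
  hence ann: "shift_op ([:-1, 1:] * F) f x = 0" for x
    by (simp add: shift_op_mult shift_op_pCons del: mult_pCons_left)
  have "f (x + int l) = f x" for x
  proof (rule periodic_of_annihilator[OF k(2,1) ann l(1)])
    fix z :: complex assume z: "z ^ k = 1" "poly ([:-1, 1:] * F) z = 0"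
    show "z ^ l = 1"
    proof (cases "z = 1")
      case False
      hence "poly F z = 0" using z(2) by simp
      moreover obtain d where d: "d > 0" "z \<in> prim_roots d" using ex_prim_roots[OF z(1) k(1)] by blast
      ultimately have "d dvd l" using l(2) by blast
      thus ?thesis using prim_roots_power_eq_1_iff[OF d(2)] by blast
    qed simp
  qed
  thus ?thesis using l(1,3) by (intro exI[of _ l] conjI allI)
qed

lemma log_power_absorbed:
  fixes c \<epsilon> :: real
  assumes "\<epsilon> > 0" "c \<ge> 1"
  shows "\<exists>P\<ge>2. \<exists>N0\<ge>2. \<forall>N\<ge>N0.
     (2 + 2 * c) * (2 * (ln N / ln 2) + 3) ^ (P + 3) * N powr (1 / 3 + 1 / ln (real P)) \<le> N powr (1 / 3 + \<epsilon>)"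
proof -
  \<comment> \<open>This makes \<open>1 / ln P\<close> at most \<open>\<epsilon> / 2\<close>; the
    other half of \<epsilon> is shared equally by the power of the logarithm and the constant
    \<open>A\<close>.\<close>
  define P where "P = nat \<lceil>exp (2 / \<epsilon>)\<rceil> + 2"
  have "exp (2 / \<epsilon>) \<le> real P" unfolding P_def by linarith
  hence "ln (exp (2 / \<epsilon>)) \<le> ln (real P)" by (intro ln_mono) auto
  hence "2 / \<epsilon> \<le> ln (real P)" by simp
  moreover from this have "ln (real P) > 0" using assms(1) by (meson divide_pos_pos less_le_trans zero_less_numeral)
  ultimately have P: "1 / ln (real P) \<le> \<epsilon> / 2" using assms(1) by (simp add: field_simps)
  \<comment> \<open>Bounding the logarithm by a multiple of \<open>N powr s\<close> costs
    \<open>\<epsilon> / 4\<close> in the exponent after raising to the power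
    \<open>P + 3\<close>.\<close>
  define s where "s = \<epsilon> / (4 * real (P + 3))"
  define C where "C = 2 / (s * ln 2) + 3"
  define A where "A = (2 + 2 * c) * C ^ (P + 3)"
  define N0 where "N0 = max 2 (A powr (4 / \<epsilon>))"
  have s: "s > 0" using assms by (simp add: s_def)
  have C: "C > 0" using s by (simp add: C_def add_pos_pos)
  have A: "A > 0" using C assms by (simp add: A_def)
  have "(2 + 2 * c) * (2 * (ln N / ln 2) + 3) ^ (P + 3) * N powr (1 / 3 + 1 / ln (real P)) \<le> N powr (1 / 3 + \<epsilon>)"
    if "N \<ge> N0" for N
  proof -
    have N: "N \<ge> 2" "A powr (4 / \<epsilon>) \<le> N" using that by (auto simp: N0_def)
    have Ns: "N powr s \<ge> 1" using N s by (simp add: ge_one_powr_ge_zero)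
    have "ln N \<le> N powr s / s" using N s by (intro ln_powr_bound) auto
    hence "2 * (ln N / ln 2) + 3 \<le> 2 * (N powr s / s / ln 2) + 3 * N powr s"
      using Ns by (intro add_mono mult_left_mono divide_right_mono) auto
    also have "\<dots> = C * N powr s" by (simp add: C_def field_simps)
    finally have "(2 * (ln N / ln 2) + 3) ^ (P + 3) \<le> (C * N powr s) ^ (P + 3)"
      using N by (intro power_mono) auto
    also have "\<dots> = C ^ (P + 3) * N powr (real (P + 3) * s)"
      using N by (simp add: power_mult_distrib powr_power del: of_nat_add power_add)
    also have "real (P + 3) * s = \<epsilon> / 4" by (simp add: s_def del: of_nat_add)
    finally have "(2 + 2 * c) * (2 * (ln N / ln 2) + 3) ^ (P + 3) \<le> A * N powr (\<epsilon> / 4)"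
      using assms by (simp add: A_def mult.assoc)
    also have "A = (A powr (4 / \<epsilon>)) powr (\<epsilon> / 4)" using A assms by (simp add: powr_powr)
    also have "\<dots> * N powr (\<epsilon> / 4) \<le> N powr (\<epsilon> / 4) * N powr (\<epsilon> / 4)"
      using N assms by (intro mult_right_mono powr_mono2) auto
    also have "\<dots> = N powr (\<epsilon> / 2)" by (simp flip: powr_add)
    finally have "(2 + 2 * c) * (2 * (ln N / ln 2) + 3) ^ (P + 3) * N powr (1 / 3 + 1 / ln (real P)) \<le>
        N powr (\<epsilon> / 2) * N powr (1 / 3 + \<epsilon> / 2)"
      using N P by (intro mult_mono powr_mono) auto
    also have "\<dots> = N powr (1 / 3 + \<epsilon>)" by (simp add: add.commute flip: powr_add)
    finally show ?thesis .
  qed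
  moreover have "P \<ge> 2" "N0 \<ge> 2" by (simp_all add: P_def N0_def)
  ultimately show ?thesis by blast
qed

section \<open>From tuples of sets to a weighted tiling\<close>

lemma psi_set_eq_image: "psi_set h u A = psi h u ` PiE {1..h} A"
  by (auto simp: psi_set_def)

text \<open>As \<open>v\<close> is nonzero, the tuple determines \<open>b\<close>, so
  representations correspond to tuples whose complementary value lies in the dilate of
  \<open>B\<close>. These are grouped by their value under \<open>psi\<close>.\<close>

lemma rep_fun_eq_sum:
  assumes v: "v \<noteq> 0" and fin: "finite (PiE {1..h} A)"
    and bounds: "\<And>a. a \<in> PiE {1..h} A \<Longrightarrow> psi h u a \<in> {a0..a0 + int n}"
  defines "w \<equiv> (\<lambda>i. card {a \<in> PiE {1..h} A. psi h u a = a0 + int i})"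
  shows "(\<Sum>i\<le>n. of_nat (w i) * of_bool (x - int i \<in> (\<lambda>b. v * b) ` B)) =
         (of_nat (rep_fun h u v A B (x + a0)) :: complex)"
proof -
  let ?T = "PiE {1..h} A" and ?I = "\<lambda>y. of_bool (y \<in> (\<lambda>b. v * b) ` B) :: complex"
  define S where "S = {a \<in> ?T. x + a0 - psi h u a \<in> (\<lambda>b. v * b) ` B}"
  have "bij_betw fst {(a, b). a \<in> ?T \<and> b \<in> B \<and> rho h u v a b = x + a0} S"
    unfolding bij_betw_def
  proof
    show "inj_on fst {(a, b). a \<in> ?T \<and> b \<in> B \<and> rho h u v a b = x + a0}"
    proof (rule inj_onI; clarsimp)
      fix a b b' assume "rho h u v a b = x + a0" "rho h u v a b' = x + a0"
      hence "v * b = v * b'" unfolding rho_def by linarith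
      thus "b = b'" using v by simp
    qed
    show "fst ` {(a, b). a \<in> ?T \<and> b \<in> B \<and> rho h u v a b = x + a0} = S"
      by (force simp: S_def rho_def image_iff)
  qed
  hence "rep_fun h u v A B (x + a0) = card S"
    unfolding rep_fun_def by (rule bij_betw_same_card)
  hence "of_nat (rep_fun h u v A B (x + a0)) = (\<Sum>a\<in>?T. ?I (x + a0 - psi h u a))"
    using fin by (simp add: S_def Int_def)
  also have "\<dots> = (\<Sum>i\<le>n. \<Sum>a\<in>{a \<in> ?T. nat (psi h u a - a0) = i}. ?I (x + a0 - psi h u a))"
    using fin bounds by (intro sum.group[symmetric]) fastforce+
  also have "\<dots> = (\<Sum>i\<le>n. of_nat (w i) * ?I (x - int i))"
  proof (intro sum.cong refl)
    fix i
    have eq: "{a \<in> ?T. nat (psi h u a - a0) = i} = {a \<in> ?T. psi h u a = a0 + int i}"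
      using bounds by force
    have "(\<Sum>a\<in>{a \<in> ?T. psi h u a = a0 + int i}. ?I (x + a0 - psi h u a)) =
          (\<Sum>a\<in>{a \<in> ?T. psi h u a = a0 + int i}. ?I (x - int i))"
      by (intro sum.cong) auto
    thus "(\<Sum>a\<in>{a \<in> ?T. nat (psi h u a - a0) = i}. ?I (x + a0 - psi h u a)) = of_nat (w i) * ?I (x - int i)"
      unfolding eq by (simp add: w_def)
  qed
  finally show ?thesis by simp
qed

text \<open>The dilate is also invariant under translation by \<open>v * l\<close>, whatever the
  sign of \<open>v\<close>, and dividing by \<open>v\<close> leaves the period \<open>l\<close> of
  \<open>B\<close>.\<close>

lemma periodic_with_of_dilate:
  assumes v: "v \<noteq> 0" and l: "l > 0"
    and per: "\<And>x. x + l \<in> (\<lambda>b. v * b) ` B \<longleftrightarrow> x \<in> (\<lambda>b. v * b) ` B"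
  shows "periodic_with B l"
proof -
  have nat: "x + int k * l \<in> (\<lambda>b. v * b) ` B \<longleftrightarrow> x \<in> (\<lambda>b. v * b) ` B" for x k
  proof (induction k)
    case (Suc k)
    have eq: "x + int (Suc k) * l = (x + int k * l) + l" by (simp add: algebra_simps)
    show ?case unfolding eq per by (rule Suc.IH)
  qed simp
  have int: "x + j * l \<in> (\<lambda>b. v * b) ` B \<longleftrightarrow> x \<in> (\<lambda>b. v * b) ` B" for x j
  proof (cases "j \<ge> 0")
    case True
    thus ?thesis using nat[of x "nat j"] by simp
  next
    case False
    thus ?thesis using nat[of "x + j * l" "nat (- j)"] by simp
  qed
  have mem: "v * y \<in> (\<lambda>b. v * b) ` B \<longleftrightarrow> y \<in> B" for y using v by auto
  have shift: "y + l \<in> B \<longleftrightarrow> y \<in> B" for y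
    using int[of "v * y" v] mem[of y] mem[of "y + l"] by (simp add: distrib_left)
  have "B + {l} = B"
  proof (intro equalityI subsetI)
    fix y assume "y \<in> B"
    hence "y - l \<in> B" using shift[of "y - l"] by simp
    thus "y \<in> B + {l}" by (auto simp: set_plus_def intro!: bexI[of _ "y - l"])
  qed (auto simp: set_plus_def shift)
  thus ?thesis using l by (simp add: periodic_with_def)
qed

theorem theorem7:
  fixes c :: real
  assumes "c < 100 * ln 2 - 2"
  shows "\<forall>\<epsilon>::real. \<epsilon> > 0 \<longrightarrow> (\<exists>n0::int.
    \<forall>(h::nat) (t::nat) (u::nat \<Rightarrow> int) (v::int) (A::nat \<Rightarrow> int set) (B::int set).
      h \<ge> 1 \<longrightarrow> t > 0 \<longrightarrow>
      (\<forall>i\<in>{1..h}. u i \<noteq> 0) \<longrightarrow> v \<noteq> 0 \<longrightarrow>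
      (\<forall>i\<in>{1..h}. finite (A i) \<and> A i \<noteq> {}) \<longrightarrow>
      diam (psi_set h u A) \<ge> n0 \<longrightarrow>
      real (\<Prod>i=1..h. card (A i)) \<le> (real_of_int (diam (psi_set h u A)) + 1) powr c \<longrightarrow>
      t_complementing t h u v A B \<longrightarrow>
      (\<exists>k. periodic_with B k \<and>
           ln (real_of_int k) \<le> (real_of_int (diam (psi_set h u A)) + 1) powr (1/3 + \<epsilon>)))"
proof (intro allI impI)
  fix \<epsilon> :: real assume \<epsilon>: "\<epsilon> > 0"
  \<comment> \<open>The period bound is proved for exponents at least 1; enlarging \<open>c\<close>
    preserves the size condition, as the base is at least 1.\<close>
  define c' where "c' = max 1 c"
  obtain P N0 where P: "P \<ge> 2" and N0: "N0 \<ge> 2" and bound: "\<And>N. N \<ge> N0 \<Longrightarrow>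
      (2 + 2 * c') * (2 * (ln N / ln 2) + 3) ^ (P + 3) * N powr (1 / 3 + 1 / ln (real P)) \<le> N powr (1 / 3 + \<epsilon>)"
    using log_power_absorbed[OF \<epsilon>, of c'] by (auto simp: c'_def)
  show "\<exists>n0::int.
    \<forall>(h::nat) (t::nat) (u::nat \<Rightarrow> int) (v::int) (A::nat \<Rightarrow> int set) (B::int set).
      h \<ge> 1 \<longrightarrow> t > 0 \<longrightarrow>
      (\<forall>i\<in>{1..h}. u i \<noteq> 0) \<longrightarrow> v \<noteq> 0 \<longrightarrow>
      (\<forall>i\<in>{1..h}. finite (A i) \<and> A i \<noteq> {}) \<longrightarrow>
      diam (psi_set h u A) \<ge> n0 \<longrightarrow>
      real (\<Prod>i=1..h. card (A i)) \<le> (real_of_int (diam (psi_set h u A)) + 1) powr c \<longrightarrow>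
      t_complementing t h u v A B \<longrightarrow>
      (\<exists>k. periodic_with B k \<and>
           ln (real_of_int k) \<le> (real_of_int (diam (psi_set h u A)) + 1) powr (1/3 + \<epsilon>))"
  proof (rule exI[of _ "\<lceil>N0\<rceil>"], intro allI impI)
    fix h t :: nat and u :: "nat \<Rightarrow> int" and v :: int and A :: "nat \<Rightarrow> int set" and B :: "int set"
    assume v: "v \<noteq> 0" and A: "\<forall>i\<in>{1..h}. finite (A i) \<and> A i \<noteq> {}"
      and diam: "diam (psi_set h u A) \<ge> \<lceil>N0\<rceil>"
      and card: "real (\<Prod>i=1..h. card (A i)) \<le> (real_of_int (diam (psi_set h u A)) + 1) powr c"
      and compl: "t_complementing t h u v A B"
    let ?T = "PiE {1..h} A" and ?\<psi> = "psi_set h u A"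
    \<comment> \<open>Measured from the minimum, the values have indices between 0 and
      \<open>n\<close>, and both end weights are positive because minimum and maximum are
      attained.\<close>
    define a0 where "a0 = Min ?\<psi>"
    define n where "n = nat (diam ?\<psi>)"
    define w where "w = (\<lambda>i. card {a \<in> ?T. psi h u a = a0 + int i})"
    define f where "f = (\<lambda>x. of_bool (x \<in> (\<lambda>b. v * b) ` B) :: complex)"
    have finT: "finite ?T" using A by (intro finite_PiE) auto
    have neT: "?T \<noteq> {}" using A by (simp add: PiE_eq_empty_iff)
    have fin\<psi>: "finite ?\<psi>" and ne\<psi>: "?\<psi> \<noteq> {}" using finT neT by (auto simp: psi_set_eq_image)
    have N0n: "real_of_int (diam ?\<psi>) \<ge> N0" using diam by linarith
    hence dn: "diam ?\<psi> = int n" "n > 0" using N0 by (auto simp: n_def)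
    have max: "Max ?\<psi> = a0 + int n" using dn(1) by (simp add: diam_def a0_def)
    have bounds: "psi h u a \<in> {a0..a0 + int n}" if "a \<in> ?T" for a
    proof -
      have "psi h u a \<in> ?\<psi>" using that by (simp add: psi_set_eq_image)
      hence "a0 \<le> psi h u a" "psi h u a \<le> Max ?\<psi>" using fin\<psi> by (auto simp: a0_def)
      thus ?thesis by (simp add: max)
    qed
    have wpos: "w i > 0" if "a0 + int i \<in> ?\<psi>" for i
      using that finT by (auto simp: w_def card_gt_0_iff psi_set_eq_image)
    have w: "w 0 > 0" "w n > 0"
      using wpos[of 0] wpos[of n] Min_in[OF fin\<psi> ne\<psi>] Max_in[OF fin\<psi> ne\<psi>] max by (simp_all add: a0_def)
    have "(\<Sum>i\<le>n. w i) = (\<Sum>i\<le>n. \<Sum>a\<in>{a \<in> ?T. nat (psi h u a - a0) = i}. 1)"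
    proof (intro sum.cong refl)
      fix i
      have "{a \<in> ?T. nat (psi h u a - a0) = i} = {a \<in> ?T. psi h u a = a0 + int i}"
        using bounds by force
      thus "w i = (\<Sum>a\<in>{a \<in> ?T. nat (psi h u a - a0) = i}. 1)" by (simp add: w_def)
    qed
    also have "\<dots> = (\<Sum>a\<in>?T. 1)"
      using finT bounds by (intro sum.group) fastforce+
    finally have "(\<Sum>i\<le>n. w i) = (\<Prod>i=1..h. card (A i))" by (simp add: card_PiE)
    hence "real (\<Sum>i\<le>n. w i) \<le> real (n + 1) powr c" using card dn by (simp add: add.commute)
    also have "\<dots> \<le> real (n + 1) powr c'" by (intro powr_mono) (auto simp: c'_def)
    finally have sum: "real (\<Sum>i\<le>n. w i) \<le> real (n + 1) powr c'" .
    have tiling: "(\<Sum>i\<le>n. of_nat (w i) * f (x - int i)) = of_nat t" for x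
      using rep_fun_eq_sum[OF v finT bounds, where B = B and x = x] compl
      by (simp add: w_def f_def t_complementing_def)
    have "\<exists>l>0. (\<forall>x. f (x + int l) = f x) \<and>
      ln (real l) \<le> (2 + 2 * c') * (2 * (ln (real (n + 1)) / ln 2) + 3) ^ (P + 3) *
             real (n + 1) powr (1 / 3 + 1 / ln (real P))"
      by (rule tiling_period[OF dn(2) _ w sum P _ tiling]) (simp_all add: c'_def f_def)
    then obtain l where l: "l > 0" "\<And>x. f (x + int l) = f x"
      "ln (real l) \<le> (2 + 2 * c') * (2 * (ln (real (n + 1)) / ln 2) + 3) ^ (P + 3) *
             real (n + 1) powr (1 / 3 + 1 / ln (real P))" by blast
    have "periodic_with B (int l)"
    proof (rule periodic_with_of_dilate[OF v])
      show "x + int l \<in> (\<lambda>b. v * b) ` B \<longleftrightarrow> x \<in> (\<lambda>b. v * b) ` B" for x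
        using l(2)[of x] by (simp only: f_def of_bool_eq_iff)
    qed (use l in simp)
    moreover have "ln (real_of_int (int l)) \<le> (real_of_int (diam ?\<psi>) + 1) powr (1/3 + \<epsilon>)"
      using l(3) bound[of "real (n + 1)"] N0n dn by (simp add: add.commute)
    ultimately show "\<exists>k. periodic_with B k \<and>
        ln (real_of_int k) \<le> (real_of_int (diam ?\<psi>) + 1) powr (1/3 + \<epsilon>)" by blast
  qed
qed

end
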